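(* The OAPT problem on tensors of size $2^{(\log N)^{o(1)}}$ and the BP-Satisfying-Pair problem on branching programs of size $2^{(\log N)^{o(1)}}$ are equivalent under near-linear time ($N^{1+o(1)}$) reductions, i.e., each reduces to the other in near-linear time.
   Context: A (nondeterministic) branching program (BP) of length $T$ and width $W$ on Boolean inputs $x_1,\dots,x_n$ is a layered directed graph with $T$ layers of $W$ nodes; all nodes of layer $i<T$ are labelled by one variable $x_{f(i)}$; edges go between consecutive layers and are marked $0$ or $1$; its size is the number of edges; it accepts $x$ iff there is a path from the first node of layer $1$ to the first node of layer $T$ using only edges whose mark equals the value of the variable labelling their starting node. BP-Satisfying-Pair: given a BP $P$ on $n$ inputs and $A,B\subseteq\{0,1\}^{n/2}$ of $N$ strings each, decide whether $P$ accepts the concatenation of some $a\in A$, $b\in B$. For even $t$, tensors $u,v\in\{0,1\}^{2\times\cdots\times2}$ ($t$ factors, size $2^t$) indexed by $i\in\{0,1\}^t$ have alternating product $p_{\mathrm{alt}}(u,v)=\bigwedge_{i_1}\bigvee_{i_2}\cdots\bigvee_{i_t}(u_i\wedge v_i)$. OAPT: given two sets $A,B$ of $N$ such tensors, decide whether some pair has $p_{\mathrm{alt}}(a,b)=0$. *)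

theory Defs
  imports Complex_Main "HOL-Library.Log_Nat"
begin

section \<open>Word RAM\<close>

text \<open>
  A word RAM with registers, a random access memory, a read-only random access input and an
  append-only output. Every value is a \<open>w\<close>-bit word: results of arithmetic are reduced modulo
  \<open>2 ^ w\<close>, and subtraction is truncated at 0. Input cells beyond the end of the input read as 0.
\<close>

datatype rexp =
    Num nat
  | Reg nat
  | Mem rexp
  | Inp rexp
  | Add rexp rexp
  | Sub rexp rexp
  | Mul rexp rexp
  | Div rexp rexp
  | Mod rexp rexp
  | Less rexp rexp
  | Equal rexp rexp

datatype com =
    Skip
  | Assign nat rexp
  | Store rexp rexp
  | Emit rexp
  | Seq com com
  | Cond rexp com com
  | While rexp com

record ram_state =
  regs :: "nat \<Rightarrow> nat"
  memory :: "nat \<Rightarrow> nat"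
  outp :: "nat list"

definition init_state :: ram_state where
  "init_state = \<lparr>regs = (\<lambda>_. 0), memory = (\<lambda>_. 0), outp = []\<rparr>"

primrec rval :: "nat \<Rightarrow> nat list \<Rightarrow> ram_state \<Rightarrow> rexp \<Rightarrow> nat" where
  "rval w inp s (Num k) = k mod 2 ^ w"
| "rval w inp s (Reg r) = regs s r"
| "rval w inp s (Mem e) = memory s (rval w inp s e)"
| "rval w inp s (Inp e) =
     (if rval w inp s e < length inp then (inp ! rval w inp s e) mod 2 ^ w else 0)"
| "rval w inp s (Add d e) = (rval w inp s d + rval w inp s e) mod 2 ^ w"
| "rval w inp s (Sub d e) = rval w inp s d - rval w inp s e"
| "rval w inp s (Mul d e) = (rval w inp s d * rval w inp s e) mod 2 ^ w"
| "rval w inp s (Div d e) = rval w inp s d div rval w inp s e"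
| "rval w inp s (Mod d e) = rval w inp s d mod rval w inp s e"
| "rval w inp s (Less d e) = of_bool (rval w inp s d < rval w inp s e) mod 2 ^ w"
| "rval w inp s (Equal d e) = of_bool (rval w inp s d = rval w inp s e) mod 2 ^ w"

text \<open>Unit cost: evaluating an expression takes one step per operation or access in it.\<close>

primrec rcost :: "rexp \<Rightarrow> nat" where
  "rcost (Num k) = 1"
| "rcost (Reg r) = 1"
| "rcost (Mem e) = rcost e + 1"
| "rcost (Inp e) = rcost e + 1"
| "rcost (Add d e) = rcost d + rcost e + 1"
| "rcost (Sub d e) = rcost d + rcost e + 1"
| "rcost (Mul d e) = rcost d + rcost e + 1"
| "rcost (Div d e) = rcost d + rcost e + 1"
| "rcost (Mod d e) = rcost d + rcost e + 1"
| "rcost (Less d e) = rcost d + rcost e + 1"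
| "rcost (Equal d e) = rcost d + rcost e + 1"

text \<open>
  \<open>exec w inp c s k s'\<close>: on input \<open>inp\<close> with word size \<open>w\<close>, the program \<open>c\<close> started in \<open>s\<close>
  halts after \<open>k\<close> steps in \<open>s'\<close>. The semantics is deterministic.
\<close>

inductive exec :: "nat \<Rightarrow> nat list \<Rightarrow> com \<Rightarrow> ram_state \<Rightarrow> nat \<Rightarrow> ram_state \<Rightarrow> bool"
  for w :: nat and inp :: "nat list" where
  Skip: "exec w inp Skip s 1 s"
| Assign: "exec w inp (Assign r e) s (rcost e + 1)
     (s\<lparr>regs := (regs s)(r := rval w inp s e)\<rparr>)"
| Store: "exec w inp (Store d e) s (rcost d + rcost e + 1)
     (s\<lparr>memory := (memory s)(rval w inp s d := rval w inp s e)\<rparr>)"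
| Emit: "exec w inp (Emit e) s (rcost e + 1) (s\<lparr>outp := outp s @ [rval w inp s e]\<rparr>)"
| Seq: "exec w inp c1 s k1 s1 \<Longrightarrow> exec w inp c2 s1 k2 s2 \<Longrightarrow>
     exec w inp (Seq c1 c2) s (k1 + k2) s2"
| CondTrue: "rval w inp s e \<noteq> 0 \<Longrightarrow> exec w inp c1 s k s1 \<Longrightarrow>
     exec w inp (Cond e c1 c2) s (rcost e + 1 + k) s1"
| CondFalse: "rval w inp s e = 0 \<Longrightarrow> exec w inp c2 s k s1 \<Longrightarrow>
     exec w inp (Cond e c1 c2) s (rcost e + 1 + k) s1"
| WhileTrue: "rval w inp s e \<noteq> 0 \<Longrightarrow> exec w inp c s k1 s1 \<Longrightarrow>
     exec w inp (While e c) s1 k2 s2 \<Longrightarrow>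
     exec w inp (While e c) s (rcost e + 1 + k1 + k2) s2"
| WhileFalse: "rval w inp s e = 0 \<Longrightarrow> exec w inp (While e c) s (rcost e + 1) s"

text \<open>
  The word size is a constant multiple \<open>c\<close> of the number of bits needed to write down the length
  of the input and each of its entries.
\<close>

definition word_size :: "nat \<Rightarrow> nat list \<Rightarrow> nat" where
  "word_size c inp = c * floorlog 2 (Max (insert (length inp) (set inp)))"

definition computes_in :: "com \<Rightarrow> nat \<Rightarrow> nat list \<Rightarrow> nat list \<Rightarrow> nat \<Rightarrow> bool" where
  "computes_in p c inp ys k \<longleftrightarrow>
     (\<exists>s. exec (word_size c inp) inp p init_state k s \<and> outp s = ys)"

section \<open>Near-linear time reductions\<close>

text \<open>The bounds \<open>2^((log N)^o(1))\<close> and \<open>N^(1+o(1))\<close>.\<close>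

definition small_size_bound :: "(nat \<Rightarrow> real) \<Rightarrow> bool" where
  "small_size_bound s \<longleftrightarrow>
     (\<exists>\<delta> :: nat \<Rightarrow> real. \<delta> \<longlonglongrightarrow> 0 \<and>
        (\<forall>\<^sub>F N in sequentially. s N \<le> 2 powr (log 2 (real N) powr \<delta> N)))"

definition near_linear :: "(nat \<Rightarrow> real) \<Rightarrow> bool" where
  "near_linear \<tau> \<longleftrightarrow>
     (\<exists>\<epsilon> :: nat \<Rightarrow> real. \<epsilon> \<longlonglongrightarrow> 0 \<and>
        (\<forall>\<^sub>F N in sequentially. \<tau> N \<le> real N powr (1 + \<epsilon> N)))"

text \<open>
  A decision problem with a set size \<open>N\<close> (\<open>num\<close>), in which the running time is measured, and a
  secondary size (\<open>dim\<close>) that is to be bounded in terms of \<open>N\<close>.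
\<close>

record 'i problem =
  inst :: "'i \<Rightarrow> bool"
  num :: "'i \<Rightarrow> nat"
  dim :: "'i \<Rightarrow> nat"
  yes :: "'i \<Rightarrow> bool"
  enc :: "'i \<Rightarrow> nat list"

text \<open>
  The problem \<open>P\<close> on instances of secondary size \<open>2^((log N)^o(1))\<close> reduces to the problem \<open>Q\<close>
  on instances of secondary size \<open>2^((log N)^o(1))\<close>: for each admissible bound for \<open>P\<close> there are
  an admissible bound for \<open>Q\<close> and a many-one reduction computed in time \<open>N^(1+o(1))\<close>.
\<close>

definition near_linear_reducible :: "'i problem \<Rightarrow> 'j problem \<Rightarrow> bool" where
  "near_linear_reducible P Q \<longleftrightarrow>
     (\<forall>s. small_size_bound s \<longrightarrow>
       (\<exists>s' \<tau> p c. small_size_bound s' \<and> near_linear \<tau> \<and>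
         (\<forall>x. inst P x \<and> real (dim P x) \<le> s (num P x) \<longrightarrow>
           (\<exists>y k. computes_in p c (enc P x) (enc Q y) k \<and> real k \<le> \<tau> (num P x) \<and>
              inst Q y \<and> real (dim Q y) \<le> s' (num Q y) \<and>
              (yes P x \<longleftrightarrow> yes Q y)))))"

definition near_linear_equivalent :: "'i problem \<Rightarrow> 'j problem \<Rightarrow> bool" where
  "near_linear_equivalent P Q \<longleftrightarrow> near_linear_reducible P Q \<and> near_linear_reducible Q P"

section \<open>Branching programs\<close>

text \<open>
  Layers, nodes and variables are numbered from 0. Layer \<open>i < bp_length - 1\<close> is labelled by the
  variable \<open>bp_labels ! i\<close>, and \<open>(i, u, v, m)\<close> is an edge from node \<open>u\<close> of layer \<open>i\<close> to node \<open>v\<close>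
  of layer \<open>i + 1\<close> with mark \<open>m\<close>.
\<close>

record bp =
  bp_inputs :: nat
  bp_length :: nat
  bp_width :: nat
  bp_labels :: "nat list"
  bp_edges :: "(nat \<times> nat \<times> nat \<times> bool) list"

definition wf_bp :: "bp \<Rightarrow> bool" where
  "wf_bp P \<longleftrightarrow>
     bp_length P \<ge> 1 \<and> bp_width P \<ge> 1 \<and>
     length (bp_labels P) = bp_length P - 1 \<and>
     (\<forall>j \<in> set (bp_labels P). j < bp_inputs P) \<and>
     distinct (bp_edges P) \<and>
     (\<forall>(i, u, v, m) \<in> set (bp_edges P).
        i + 1 < bp_length P \<and> u < bp_width P \<and> v < bp_width P)"

definition bp_size :: "bp \<Rightarrow> nat" where
  "bp_size P = length (bp_edges P)"

definition bp_accepts :: "bp \<Rightarrow> bool list \<Rightarrow> bool" where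
  "bp_accepts P x \<longleftrightarrow>
     (\<exists>path :: nat list. length path = bp_length P \<and>
        path ! 0 = 0 \<and> path ! (bp_length P - 1) = 0 \<and>
        (\<forall>i < bp_length P - 1.
           (i, path ! i, path ! (i + 1), x ! (bp_labels P ! i)) \<in> set (bp_edges P)))"

text \<open>The sets \<open>A\<close> and \<open>B\<close> are given by lists without repetition.\<close>

record bpsp =
  bpsp_bp :: bp
  bpsp_A :: "bool list list"
  bpsp_B :: "bool list list"

definition bpsp_inst :: "bpsp \<Rightarrow> bool" where
  "bpsp_inst I \<longleftrightarrow>
     wf_bp (bpsp_bp I) \<and> even (bp_inputs (bpsp_bp I)) \<and>
     distinct (bpsp_A I) \<and> distinct (bpsp_B I) \<and> length (bpsp_A I) = length (bpsp_B I) \<and>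
     (\<forall>a \<in> set (bpsp_A I) \<union> set (bpsp_B I). length a = bp_inputs (bpsp_bp I) div 2)"

definition bpsp_yes :: "bpsp \<Rightarrow> bool" where
  "bpsp_yes I \<longleftrightarrow>
     (\<exists>a \<in> set (bpsp_A I). \<exists>b \<in> set (bpsp_B I). bp_accepts (bpsp_bp I) (a @ b))"

definition enc_bits :: "bool list list \<Rightarrow> nat list" where
  "enc_bits xss = map of_bool (concat xss)"

definition enc_edge :: "nat \<times> nat \<times> nat \<times> bool \<Rightarrow> nat list" where
  "enc_edge = (\<lambda>(i, u, v, m). [i, u, v, of_bool m])"

definition enc_bpsp :: "bpsp \<Rightarrow> nat list" where
  "enc_bpsp I =
     [length (bpsp_A I), bp_inputs (bpsp_bp I), bp_length (bpsp_bp I), bp_width (bpsp_bp I),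
      length (bp_edges (bpsp_bp I))]
     @ bp_labels (bpsp_bp I)
     @ concat (map enc_edge (bp_edges (bpsp_bp I)))
     @ enc_bits (bpsp_A I) @ enc_bits (bpsp_B I)"

definition BP_Satisfying_Pair :: "bpsp problem" where
  "BP_Satisfying_Pair =
     \<lparr>inst = bpsp_inst, num = (\<lambda>I. length (bpsp_A I)), dim = (\<lambda>I. bp_size (bpsp_bp I)),
      yes = bpsp_yes, enc = enc_bpsp\<rparr>"

section \<open>Orthogonal alternating product tensors\<close>

text \<open>
  A tensor with \<open>t\<close> factors is the list of its \<open>2 ^ t\<close> entries in lexicographic order of the
  indices in \<open>{0,1}^t\<close>; an index is a list of \<open>t\<close> bits.
\<close>

type_synonym tensor = "bool list"

definition tensor_at :: "tensor \<Rightarrow> bool list \<Rightarrow> bool" where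
  "tensor_at u i = u ! foldl (\<lambda>k b. 2 * k + of_bool b) 0 i"

fun alt_all :: "nat \<Rightarrow> (bool list \<Rightarrow> bool) \<Rightarrow> bool"
  and alt_ex :: "nat \<Rightarrow> (bool list \<Rightarrow> bool) \<Rightarrow> bool" where
  "alt_all 0 g = g []"
| "alt_all (Suc t) g = (\<forall>b. alt_ex t (\<lambda>i. g (b # i)))"
| "alt_ex 0 g = g []"
| "alt_ex (Suc t) g = (\<exists>b. alt_all t (\<lambda>i. g (b # i)))"

definition p_alt :: "nat \<Rightarrow> tensor \<Rightarrow> tensor \<Rightarrow> bool" where
  "p_alt t u v = alt_all t (\<lambda>i. tensor_at u i \<and> tensor_at v i)"

record oapt =
  oapt_t :: nat
  oapt_A :: "tensor list"
  oapt_B :: "tensor list"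

definition oapt_inst :: "oapt \<Rightarrow> bool" where
  "oapt_inst I \<longleftrightarrow>
     even (oapt_t I) \<and>
     distinct (oapt_A I) \<and> distinct (oapt_B I) \<and> length (oapt_A I) = length (oapt_B I) \<and>
     (\<forall>u \<in> set (oapt_A I) \<union> set (oapt_B I). length u = 2 ^ oapt_t I)"

definition oapt_yes :: "oapt \<Rightarrow> bool" where
  "oapt_yes I \<longleftrightarrow> (\<exists>a \<in> set (oapt_A I). \<exists>b \<in> set (oapt_B I). \<not> p_alt (oapt_t I) a b)"

definition enc_oapt :: "oapt \<Rightarrow> nat list" where
  "enc_oapt I =
     [length (oapt_A I), oapt_t I] @ enc_bits (oapt_A I) @ enc_bits (oapt_B I)"

definition OAPT :: "oapt problem" where
  "OAPT =
     \<lparr>inst = oapt_inst, num = (\<lambda>I. length (oapt_A I)), dim = (\<lambda>I. 2 ^ oapt_t I),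
      yes = oapt_yes, enc = enc_oapt\<rparr>"

end

theory Submission
  imports Defs "HOL-Real_Asymp.Real_Asymp"
begin

text \<open>
  From tensors to branching programs: the negation of \<open>p_alt\<close> is an alternating formula whose
  leaves \<open>\<not> (u\<^sub>i \<and> v\<^sub>i)\<close> are visited from left to right with short-circuiting. A node of the
  branching program is the next leaf to be visited, and since the order of the leaves is fixed, all
  nodes can wait for the two layers that read this leaf. The vectors are copied unchanged.

  From branching programs to tensors: Savitch's recursion guesses the middle edge of an accepting path
  and universally picks one of the halves. With \<open>2^m\<close> exceeding the number of edges, \<open>m\<close> levels
  of \<open>m\<close> guessed bits suffice, which gives tensors of size \<open>2^O(m^2)\<close>; padding with dummy
  universal bits makes the quantifiers alternate. A leaf compares two consecutive edges and one bit of
  \<open>a\<close> or of \<open>b\<close>, so it is a conjunction of a bit depending on \<open>a\<close> and one depending on \<open>b\<close>.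

  Both reductions are given as RAM programs that only use registers. The word size constant depends on
  the size bound, so that the finitely many small \<open>N\<close> cause no overflow.
\<close>

section \<open>Weakest preconditions with step counts\<close>

text \<open>The running time may depend only on \<open>N\<close> and the secondary size, but the
  length and width of a branching program, its number of inputs and thus the length of the rows are
  bounded by neither. So the reduction to tensors can neither scan its input nor copy the rows:
  every entry is computed from its position alone, by random access to the few input cells that
  matter, and the recursion depth is bounded through the number of edges. Lists must have no
  repetition, yet different rows may agree on all variables that the edges read. So every tensor
  also carries its row number where it cannot influence the value, and the depth has to grow with
  log log N to make room for it. The sizes fit because a blow-up from s to 2^O((log s)^2) only
  doubles the exponent o(1) of log N, up to vanishing terms, while time N * s^O(1) is N^(1+o(1)) for
  s = 2^((log N)^o(1)).\<close>

definition wp :: "nat \<Rightarrow> nat list \<Rightarrow> com \<Rightarrow> (nat \<Rightarrow> ram_state \<Rightarrow> bool) \<Rightarrow> ram_state \<Rightarrow> bool" where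
  "wp w inp c Q s \<longleftrightarrow> (\<exists>k s'. exec w inp c s k s' \<and> Q k s')"

inductive_cases exec_SkipE: "exec w inp Skip s k s'"
inductive_cases exec_AssignE: "exec w inp (Assign r e) s k s'"
inductive_cases exec_EmitE: "exec w inp (Emit e) s k s'"
inductive_cases exec_SeqE: "exec w inp (Seq c1 c2) s k s'"
inductive_cases exec_CondE: "exec w inp (Cond e c1 c2) s k s'"

text \<open>
  The equations are stated for unapplied \<open>wp\<close>, so that the simplifier can use them in
  postconditions.
\<close>

lemma wp_Skip [simp]: "wp w inp Skip Q = Q 1"
  unfolding wp_def fun_eq_iff by (metis exec_SkipE exec.Skip)

lemma wp_Assign [simp]:
  "wp w inp (Assign r e) Q =
     (\<lambda>s. Q (rcost e + 1) (s\<lparr>regs := (regs s)(r := rval w inp s e)\<rparr>))"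
  unfolding wp_def fun_eq_iff by (metis exec_AssignE exec.Assign)

lemma wp_Emit [simp]:
  "wp w inp (Emit e) Q =
     (\<lambda>s. Q (rcost e + 1) (s\<lparr>outp := outp s @ [rval w inp s e]\<rparr>))"
  unfolding wp_def fun_eq_iff by (metis exec_EmitE exec.Emit)

lemma wp_Seq [simp]:
  "wp w inp (Seq c1 c2) Q = wp w inp c1 (\<lambda>k1. wp w inp c2 (\<lambda>k2. Q (k1 + k2)))"
  unfolding wp_def fun_eq_iff by (blast elim: exec_SeqE intro: exec.Seq)

lemma wp_Cond [simp]:
  "wp w inp (Cond e c1 c2) Q =
     (\<lambda>s. if rval w inp s e \<noteq> 0 then wp w inp c1 (\<lambda>k. Q (rcost e + 1 + k)) s
      else wp w inp c2 (\<lambda>k. Q (rcost e + 1 + k)) s)"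
proof
  fix s
  show "wp w inp (Cond e c1 c2) Q s =
     (if rval w inp s e \<noteq> 0 then wp w inp c1 (\<lambda>k. Q (rcost e + 1 + k)) s
      else wp w inp c2 (\<lambda>k. Q (rcost e + 1 + k)) s)"
  proof (cases "rval w inp s e = 0")
    case True
    have "exec w inp (Cond e c1 c2) s k s' \<longleftrightarrow>
        (\<exists>k'. k = rcost e + 1 + k' \<and> exec w inp c2 s k' s')" for k s'
      using True exec.CondFalse[OF True] by (auto elim!: exec_CondE simp del: add_Suc_right)
    with True show ?thesis unfolding wp_def by auto
  next
    case False
    have "exec w inp (Cond e c1 c2) s k s' \<longleftrightarrow>
        (\<exists>k'. k = rcost e + 1 + k' \<and> exec w inp c1 s k' s')" for k s'
      using False exec.CondTrue[OF False] by (auto elim!: exec_CondE simp del: add_Suc_right)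
    with False show ?thesis unfolding wp_def by auto
  qed
qed

lemma wp_While_True:
  assumes "rval w inp s e \<noteq> 0"
    and "wp w inp c (\<lambda>k1. wp w inp (While e c) (\<lambda>k2. Q (rcost e + 1 + k1 + k2))) s"
  shows "wp w inp (While e c) Q s"
  using assms unfolding wp_def by (blast intro: exec.WhileTrue)

lemma wp_While_False:
  assumes "rval w inp s e = 0" "Q (rcost e + 1) s"
  shows "wp w inp (While e c) Q s"
  using assms unfolding wp_def by (blast intro: exec.WhileFalse)

lemma wp_mono:
  assumes "wp w inp c Q s" "\<And>k s'. Q k s' \<Longrightarrow> R k s'"
  shows "wp w inp c R s"
  using assms unfolding wp_def by blast

text \<open>Indexing the invariant by the iteration number replaces a termination order: exactly
  \<open>n\<close> rounds run, so the cost is that of \<open>n\<close> tests and bodies plus the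
  last failing test.\<close>

lemma wp_while:
  assumes "I 0 s"
    and step: "\<And>j s. j < n \<Longrightarrow> I j s \<Longrightarrow>
      rval w inp s e \<noteq> 0 \<and> wp w inp c (\<lambda>k s'. k \<le> tb \<and> I (Suc j) s') s"
    and stop: "\<And>s. I n s \<Longrightarrow> rval w inp s e = 0"
  shows "wp w inp (While e c) (\<lambda>k s'. k \<le> n * (rcost e + 1 + tb) + rcost e + 1 \<and> I n s') s"
proof -
  have "wp w inp (While e c) (\<lambda>k s'. k \<le> (n - j) * (rcost e + 1 + tb) + rcost e + 1 \<and> I n s') s"
    if "j \<le> n" "I j s" for j s
    using that
  proof (induction "n - j" arbitrary: j s)
    case 0
    then show ?case by (intro wp_While_False) (auto simp: stop)
  next
    case (Suc d)
    then have j: "j < n" by simp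
    have d: "n - j = Suc (n - Suc j)" using j by simp
    show ?case
    proof (rule wp_While_True)
      show "rval w inp s e \<noteq> 0" using step j Suc.prems by blast
      show "wp w inp c (\<lambda>k1. wp w inp (While e c) (\<lambda>k2 s'. rcost e + 1 + k1 + k2
          \<le> (n - j) * (rcost e + 1 + tb) + rcost e + 1 \<and> I n s')) s"
      proof (rule wp_mono)
        show "wp w inp c (\<lambda>k s'. k \<le> tb \<and> I (Suc j) s') s" using step j Suc.prems by blast
      next
        fix k1 s1 assume k1: "k1 \<le> tb \<and> I (Suc j) s1"
        show "wp w inp (While e c) (\<lambda>k2 s'. rcost e + 1 + k1 + k2
          \<le> (n - j) * (rcost e + 1 + tb) + rcost e + 1 \<and> I n s') s1"
          by (rule wp_mono[OF Suc.hyps(1)[of "Suc j"]]) (use k1 j Suc.hyps(2) in \<open>auto simp: d\<close>)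
      qed
    qed
  qed
  from this[of 0 s] show ?thesis using assms(1) by simp
qed

section \<open>Frame conditions and counting loops\<close>

primrec writes :: "com \<Rightarrow> nat set" where
  "writes Skip = {}"
| "writes (Assign r e) = {r}"
| "writes (Store d e) = {}"
| "writes (Emit e) = {}"
| "writes (Seq c1 c2) = writes c1 \<union> writes c2"
| "writes (Cond e c1 c2) = writes c1 \<union> writes c2"
| "writes (While e c) = writes c"

primrec silent :: "com \<Rightarrow> bool" where
  "silent Skip = True"
| "silent (Assign r e) = True"
| "silent (Store d e) = True"
| "silent (Emit e) = False"
| "silent (Seq c1 c2) = (silent c1 \<and> silent c2)"
| "silent (Cond e c1 c2) = (silent c1 \<and> silent c2)"
| "silent (While e c) = silent c"

lemma exec_frame:
  "exec w inp c s k s' \<Longrightarrow>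
     (\<forall>r. r \<notin> writes c \<longrightarrow> regs s' r = regs s r) \<and> (silent c \<longrightarrow> outp s' = outp s)"
  by (induction rule: exec.induct) auto

text \<open>Specifications can thus be limited to the registers that a program is meant to produce;
  whatever else survives is read off syntactically from \<open>writes\<close> and
  \<open>silent\<close>.\<close>

lemma wp_frame:
  assumes "wp w inp c Q s"
    and "\<And>k s'. Q k s' \<Longrightarrow> \<forall>r. r \<notin> writes c \<longrightarrow> regs s' r = regs s r \<Longrightarrow>
      silent c \<longrightarrow> outp s' = outp s \<Longrightarrow> R k s'"
  shows "wp w inp c R s"
  using assms exec_frame unfolding wp_def by blast

definition for_loop :: "nat \<Rightarrow> nat \<Rightarrow> com \<Rightarrow> com" where
  "for_loop i b c = Seq (Assign i (Num 0))
     (While (Less (Reg i) (Reg b)) (Seq c (Assign i (Add (Reg i) (Num 1)))))"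

lemma writes_for_loop [simp]: "writes (for_loop i b c) = insert i (writes c)"
  by (auto simp: for_loop_def)

text \<open>Each iteration adds 8 to the body, 4 for the test and 4 for the increment; the 6 are the
  initialisation and the failing test. Since \<open>n < 2 ^ w\<close>, the counter reaches
  \<open>n\<close> without wrapping around.\<close>

lemma wp_for_loop:
  assumes n: "regs s b = n" "n < 2 ^ w" "0 < w"
    and fresh: "i \<notin> writes c" "b \<notin> writes c" "b \<noteq> i"
    and body: "\<And>j s'. j < n \<Longrightarrow> regs s' i = j \<Longrightarrow>
      \<forall>r. r \<notin> insert i (writes c) \<longrightarrow> regs s' r = regs s r \<Longrightarrow>
      wp w inp c (\<lambda>k s''. k \<le> tb \<and> outp s'' = outp s' @ f j) s'"
  shows "wp w inp (for_loop i b c)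
    (\<lambda>k s'. k \<le> n * (tb + 8) + 6 \<and> outp s' = outp s @ concat (map f [0..<n]) \<and>
      (\<forall>r. r \<notin> insert i (writes c) \<longrightarrow> regs s' r = regs s r)) s"
proof -
  let ?I = "\<lambda>j (s'::ram_state). regs s' i = j \<and> outp s' = outp s @ concat (map f [0..<j]) \<and>
    (\<forall>r. r \<notin> insert i (writes c) \<longrightarrow> regs s' r = regs s r)"
  let ?s = "s\<lparr>regs := (regs s)(i := 0)\<rparr>"
  have "wp w inp (While (Less (Reg i) (Reg b)) (Seq c (Assign i (Add (Reg i) (Num 1)))))
    (\<lambda>k s'. k \<le> n * (rcost (Less (Reg i) (Reg b)) + 1 + (tb + 4)) + rcost (Less (Reg i) (Reg b)) + 1 \<and> ?I n s') ?s"
  proof (rule wp_while[where I = ?I])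
    show "?I 0 ?s" by simp
  next
    fix j and s' :: ram_state assume j: "j < n" and I: "?I j s'"
    have "rval w inp s' (Less (Reg i) (Reg b)) \<noteq> 0" using j I n fresh by simp
    moreover have "wp w inp c (\<lambda>k s''. wp w inp (Assign i (Add (Reg i) (Num 1)))
        (\<lambda>k'. (\<lambda>k s'. k \<le> tb + 4 \<and> ?I (Suc j) s') (k + k')) s'') s'"
    proof (rule wp_frame)
      show "wp w inp c (\<lambda>k s''. k \<le> tb \<and> outp s'' = outp s' @ f j) s'"
        using body j I by blast
    qed (use j I n fresh in auto)
    ultimately show "rval w inp s' (Less (Reg i) (Reg b)) \<noteq> 0 \<and> 
      wp w inp (Seq c (Assign i (Add (Reg i) (Num 1)))) (\<lambda>k s'. k \<le> tb + 4 \<and> ?I (Suc j) s') s'"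
      by simp
  next
    fix s' :: ram_state assume "?I n s'"
    then show "rval w inp s' (Less (Reg i) (Reg b)) = 0" using n fresh by simp
  qed
  then have "wp w inp (While (Less (Reg i) (Reg b)) (Seq c (Assign i (Add (Reg i) (Num 1)))))
    (\<lambda>k s'. 2 + k \<le> n * (tb + 8) + 6 \<and> outp s' = outp s @ concat (map f [0..<n]) \<and>
      (\<forall>r. r \<notin> insert i (writes c) \<longrightarrow> regs s' r = regs s r)) ?s"
    by (rule wp_mono) (auto simp: algebra_simps)
  then show ?thesis by (simp add: for_loop_def)
qed

definition pow_loop :: "nat \<Rightarrow> nat \<Rightarrow> nat \<Rightarrow> com" where
  "pow_loop a b \<beta> = While (Reg a)
     (Seq (Assign b (Mul (Num \<beta>) (Reg b))) (Assign a (Sub (Reg a) (Num 1))))"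

lemma writes_pow_loop [simp]: "writes (pow_loop a b \<beta>) = {a, b}" "silent (pow_loop a b \<beta>)"
  by (auto simp: pow_loop_def)

lemma wp_pow_loop:
  assumes "a \<noteq> b" "regs s a = n" "regs s b = 1" "\<beta> ^ n < 2 ^ w" "\<beta> < 2 ^ w" "0 < w" "0 < \<beta>"
  shows "wp w inp (pow_loop a b \<beta>) (\<lambda>k s'. k \<le> n * 10 + 2 \<and> regs s' b = \<beta> ^ n) s"
proof -
  let ?I = "\<lambda>j (s'::ram_state). regs s' a = n - j \<and> regs s' b = \<beta> ^ j"
  have "wp w inp (While (Reg a)
     (Seq (Assign b (Mul (Num \<beta>) (Reg b))) (Assign a (Sub (Reg a) (Num 1)))))
    (\<lambda>k s'. k \<le> n * (rcost (Reg a) + 1 + 8) + rcost (Reg a) + 1 \<and> ?I n s') s"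
  proof (rule wp_while[where I = ?I])
    fix j and s' :: ram_state assume j: "j < n" and I: "?I j s'"
    have "\<beta> ^ Suc j \<le> \<beta> ^ n" using j assms by (intro power_increasing) auto
    then have "\<beta> * \<beta> ^ j < 2 ^ w" using assms by simp
    then show "rval w inp s' (Reg a) \<noteq> 0 \<and> wp w inp (Seq (Assign b (Mul (Num \<beta>) (Reg b))) (Assign a (Sub (Reg a) (Num 1)))) (\<lambda>k s'. k \<le> 8 \<and> ?I (Suc j) s') s'"
      using j I assms by auto
  qed (use assms in auto)
  then show ?thesis unfolding pow_loop_def by (rule wp_mono) auto
qed

primrec seqs :: "com list \<Rightarrow> com" where
  "seqs [] = Skip"
| "seqs (c # cs) = Seq c (seqs cs)"

section \<open>Short-circuit evaluation of alternating formulas\<close>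

text \<open>Appending the bits \<open>i\<close> to \<open>a\<close> keeps \<open>a\<close> as the
  leading part. For \<open>a = 0\<close> the quotient 0 means that the index is below
  \<open>2 ^ length i\<close>.\<close>

lemma foldl_bits_div: "foldl (\<lambda>k b. 2 * k + of_bool b) a i div 2 ^ length i = (a::nat)"
  by (induction i arbitrary: a) (simp_all add: div_mult2_eq power_Suc2 del: power_Suc)

lemma not_alt:
  "(\<not> alt_all t g) = alt_ex t (\<lambda>i. \<not> g i)"
  "(\<not> alt_ex t g) = alt_all t (\<lambda>i. \<not> g i)"
proof (induction t arbitrary: g)
  case (Suc t)
  { case 1 show ?case by (simp only: alt_all.simps alt_ex.simps not_all Suc) }
  { case 2 show ?case by (simp only: alt_all.simps alt_ex.simps not_ex Suc) }
qed simp_all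

lemma alt_cong:
  assumes "\<And>i. length i = t \<Longrightarrow> g i = h i"
  shows "alt_all t g = alt_all t h" "alt_ex t g = alt_ex t h"
proof -
  have "alt_all t g = alt_all t h \<and> alt_ex t g = alt_ex t h"
    using assms
  proof (induction t arbitrary: g h)
    case (Suc t)
    then have "alt_all t (\<lambda>i. g (b # i)) = alt_all t (\<lambda>i. h (b # i)) \<and>
        alt_ex t (\<lambda>i. g (b # i)) = alt_ex t (\<lambda>i. h (b # i))" for b
      by (intro Suc.IH) simp
    then show ?case by simp
  qed simp
  then show "alt_all t g = alt_all t h" "alt_ex t g = alt_ex t h" by auto
qed

text \<open>
  The leaf visited after leaf \<open>m\<close> has evaluated to \<open>c\<close>. The lowest quantifier is universal, so a
  true leaf decides nothing as long as it is a left child, while a false leaf decides its parent.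
  Running off the end yields the leaf number \<open>2^t\<close> for true and \<open>2 * 2^t\<close> for false.
\<close>

function next_leaf :: "bool \<Rightarrow> nat \<Rightarrow> nat" where
  "next_leaf True m = (if even m then m + 1 else 2 * next_leaf False (m div 2))"
| "next_leaf False m = 2 * next_leaf True (m div 2)"
  by pat_completeness auto
termination
  \<comment> \<open>\<open>next_leaf False 0\<close> calls \<open>next_leaf True 0\<close> with the
    same number, so the flag must count; the factor 2 makes room for it in the call that changes the
    flag from true to false.\<close>
  by (relation "measure (\<lambda>(c, m). 2 * m + (if c then 0 else 1))") (auto elim!: oddE)

declare next_leaf.simps [simp del]

lemma next_leaf_gt: "m < next_leaf c m"
proof (induction c m rule: next_leaf.induct)
  case (1 m)
  then show ?case by (cases "even m") (auto simp: next_leaf.simps(1)[of m])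
next
  case (2 m)
  then show ?case by (simp add: next_leaf.simps(2)[of m])
qed

lemma next_leaf_le: "m < 2 ^ t \<Longrightarrow> next_leaf c m \<le> 2 ^ Suc t"
proof (induction t arbitrary: c m)
  case 0
  then show ?case by (cases c) (simp_all add: next_leaf.simps(1)[of 0] next_leaf.simps(2)[of 0])
next
  case (Suc t)
  then have "next_leaf d (m div 2) \<le> 2 ^ Suc t" for d by (simp add: less_mult_imp_div_less)
  from this[of "\<not> c"] show ?case using Suc.prems by (cases c) (auto simp: next_leaf.simps(1)[of m] next_leaf.simps(2)[of m])
qed

text \<open>
  The value of the subtree of height \<open>d\<close> whose leaves are \<open>m * 2^d, \<dots>, (m + 1) * 2^d - 1\<close>.
\<close>

primrec subtree_value :: "(nat \<Rightarrow> bool) \<Rightarrow> nat \<Rightarrow> nat \<Rightarrow> bool" where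
  "subtree_value g 0 m = g m"
| "subtree_value g (Suc d) m =
     (if even d then subtree_value g d (2 * m) \<and> subtree_value g d (2 * m + 1)
      else subtree_value g d (2 * m) \<or> subtree_value g d (2 * m + 1))"

lemma subtree_value_alt:
  "subtree_value g d m =
     (if even d then alt_ex d (\<lambda>i. g (foldl (\<lambda>k b. 2 * k + of_bool b) m i))
      else alt_all d (\<lambda>i. g (foldl (\<lambda>k b. 2 * k + of_bool b) m i)))"
  by (induction d arbitrary: m) (auto simp: all_bool_eq ex_bool_eq)

section \<open>Left-to-right search over the leaves\<close>

definition visit :: "(nat \<Rightarrow> bool) \<Rightarrow> nat \<Rightarrow> nat \<Rightarrow> nat" where
  "visit g k v = (if v = k then next_leaf (g k) k else v)"

definition search_from :: "(nat \<Rightarrow> bool) \<Rightarrow> nat \<Rightarrow> nat \<Rightarrow> nat" where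
  "search_from g L v = fold (visit g) [v..<L] v"

text \<open>The state \<open>v\<close> waits until leaf \<open>v\<close> comes up, so a fold over
  all leaves in their fixed order simulates jumps.\<close>

lemma fold_visit_idle:
  assumes "k \<le> v"
  shows "fold (visit g) [k..<L] v = search_from g L v"
proof (cases "v \<le> L")
  case True
  then have *: "[k..<L] = [k..<v] @ [v..<L]" using assms by (metis le_iff_add upt_add_eq_append)
  have "fold (visit g) [k..<n] v = v" if "n \<le> v" for n
    using that by (induction n) (auto simp: visit_def)
  then show ?thesis unfolding * search_from_def by simp
next
  case False
  have "fold (visit g) [k..<n] v = v" if "n \<le> v" for n
    using that by (induction n) (auto simp: visit_def)
  from this[of L] show ?thesis using False by (simp add: search_from_def)
qed

lemma search_from_step:
  assumes "k < L"
  shows "search_from g L k = search_from g L (next_leaf (g k) k)"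
  using assms next_leaf_gt[of k "g k"]
  by (simp add: search_from_def[of g L k] upt_conv_Cons visit_def[of g k k] fold_visit_idle)

text \<open>The flag of \<open>next_leaf\<close> means that the parent stays undecided as long as
  the node is a left child. At even height the parent is a conjunction, which true leaves open; at
  odd height it is a disjunction, which false leaves open. Hence a subtree passes on the flag
  \<open>subtree_value g d m = even d\<close>, which flips on each level where the value is handed
  up.\<close>

lemma search_from_subtree:
  assumes "m < 2 ^ (t - d)" "d \<le> t"
  shows "search_from g (2 ^ t) (m * 2 ^ d) =
    search_from g (2 ^ t) (2 ^ d * next_leaf (subtree_value g d m = even d) m)"
  using assms
proof (induction d arbitrary: m)
  case 0
  then show ?case using search_from_step[of m "2 ^ t" g] by simp
next
  case (Suc d)
  have e: "t - d = Suc (t - Suc d)" using Suc.prems by simp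
  have 1: "search_from g (2 ^ t) (n * 2 ^ d) =
    search_from g (2 ^ t) (2 ^ d * next_leaf (subtree_value g d n = even d) n)"
    if "n = 2 * m \<or> n = 2 * m + 1" for n
    using Suc.IH[of n] Suc.prems that by (auto simp: e)
  have T: "next_leaf True (2 * m) = 2 * m + 1" "next_leaf True (2 * m + 1) = 2 * next_leaf False m"
    "next_leaf False (2 * m) = 2 * next_leaf True m" "next_leaf False (2 * m + 1) = 2 * next_leaf True m"
    by (simp_all add: next_leaf.simps(1)[of "2 * m"] next_leaf.simps(1)[of "2 * m + 1", simplified]
        next_leaf.simps(2)[of "2 * m"] next_leaf.simps(2)[of "2 * m + 1", simplified])
  have 2: "m * 2 ^ Suc d = 2 * m * 2 ^ d" "2 ^ Suc d * x = 2 ^ d * (2 * x)" for x :: nat by auto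
  let ?S = "search_from g (2 ^ t)" and ?v = "subtree_value g d"
  have a: "?S (2 * m * 2 ^ d) = ?S (2 ^ d * next_leaf (?v (2 * m) = even d) (2 * m))"
    using 1 by simp
  have b: "?S (2 ^ d * (2 * m + 1)) = ?S (2 ^ d * next_leaf (?v (2 * m + 1) = even d) (2 * m + 1))"
    using 1[OF disjI2[OF refl]] by (simp only: mult.commute)
  show ?case
  proof (cases "?v (2 * m) = even d")
    \<comment> \<open>The left child leaves the parent open, so the search goes on with the right
      child; in the other case both the right child and its leaves are skipped.\<close>
    case True
    have "?S (2 * m * 2 ^ d) = ?S (2 ^ d * next_leaf (?v (2 * m + 1) = even d) (2 * m + 1))"
      using a True b by (simp only: T simp_thms)
    also have "next_leaf (?v (2 * m + 1) = even d) (2 * m + 1) =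
        2 * next_leaf (subtree_value g (Suc d) m = even (Suc d)) m"
      using True T by (cases "even d"; cases "?v (2 * m + 1)") simp_all
    finally show ?thesis unfolding 2 .
  next
    case False
    then have "(subtree_value g (Suc d) m = even (Suc d)) = True" by auto
    then show ?thesis unfolding 2 using a False by (simp only: T simp_thms)
  qed
qed

lemma search_from_root:
  assumes "even t"
  shows "search_from g (2 ^ t) 0 =
    (if alt_ex t (\<lambda>i. g (foldl (\<lambda>k b. 2 * k + of_bool b) 0 i)) then 2 ^ t else 2 * 2 ^ t)"
  using search_from_subtree[of 0 t t g] assms
  by (auto simp: subtree_value_alt next_leaf.simps(1)[of 0] next_leaf.simps(2)[of 0] search_from_def)

text \<open>
  Layers \<open>2 * k\<close> and \<open>2 * k + 1\<close> read the two bits of leaf \<open>k\<close>; the last layer sends the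
  accepting node \<open>L\<close> to node 0.
\<close>

definition search_target :: "nat \<Rightarrow> nat \<Rightarrow> nat \<Rightarrow> bool \<Rightarrow> nat" where
  "search_target L j v b =
     (if j = 2 * L then if v = L then 0 else 1
      else if v \<noteq> j div 2 \<or> b \<and> even j then v
      else next_leaf (\<not> b) v)"

text \<open>All triples of layer, node and mark are enumerated as mixed-radix numbers
  \<open>r\<close>, so that one counting loop can print the edges.\<close>

definition search_edge :: "nat \<Rightarrow> nat \<Rightarrow> nat \<times> nat \<times> nat \<times> bool" where
  "search_edge L r =
     (let j = r div 2 div (2 * L + 1); v = r div 2 mod (2 * L + 1)
      in (j, v, search_target L j v (odd r), odd r))"

text \<open>The last labelled layer \<open>2 * L\<close> receives the variable \<open>L\<close>. Any
  valid variable would do, because \<open>search_target\<close> ignores the bit in this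
  layer.\<close>

definition search_label :: "nat \<Rightarrow> nat \<Rightarrow> nat" where
  "search_label L j = (j mod 2) * L + j div 2"

definition search_bp :: "nat \<Rightarrow> bp" where
  "search_bp L =
     \<lparr>bp_inputs = 2 * L, bp_length = 2 * L + 2, bp_width = 2 * L + 1,
      bp_labels = map (search_label L) [0..<2 * L + 1],
      bp_edges = map (search_edge L) [0..<2 * (2 * L + 1) * (2 * L + 1)]\<rparr>"

lemma search_target_le:
  assumes "j \<le> 2 * 2 ^ t" "v \<le> 2 * 2 ^ t"
  shows "search_target (2 ^ t) j v b \<le> 2 * 2 ^ t"
proof -
  have "next_leaf (\<not> b) v \<le> 2 * 2 ^ t" if "j \<noteq> 2 * 2 ^ t" "v = j div 2"
    using next_leaf_le[of v t "\<not> b"] that assms by auto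
  then show ?thesis using assms by (auto simp: search_target_def)
qed

lemma search_edges:
  "set (map (search_edge L) [0..<2 * (2 * L + 1) * (2 * L + 1)]) =
     {(j, v, search_target L j v b, b) | j v b. j \<le> 2 * L \<and> v \<le> 2 * L}"
    (is "?E = ?F")
proof
  show "?E \<subseteq> ?F"
  proof
    fix e assume "e \<in> ?E"
    then obtain r where r: "r < 2 * (2 * L + 1) * (2 * L + 1)" "e = search_edge L r"
      unfolding set_map set_upt by (elim imageE, unfold atLeastLessThan_iff) blast
    then have "r div 2 < (2 * L + 1) * (2 * L + 1)" by (auto simp: less_mult_imp_div_less)
    then have "r div 2 div (2 * L + 1) < 2 * L + 1" by (simp add: less_mult_imp_div_less)
    moreover have "r div 2 mod (2 * L + 1) < 2 * L + 1" by simp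
    ultimately have "r div 2 div (2 * L + 1) \<le> 2 * L" "r div 2 mod (2 * L + 1) \<le> 2 * L"
      by linarith+
    then show "e \<in> ?F" unfolding r search_edge_def Let_def by blast
  qed
  show "?F \<subseteq> ?E"
  proof
    fix e assume "e \<in> ?F"
    then obtain j v b where e: "e = (j, v, search_target L j v b, b)" "j \<le> 2 * L" "v \<le> 2 * L" by auto
    define r where "r = 2 * (j * (2 * L + 1) + v) + of_bool b"
    have 1: "r div 2 = j * (2 * L + 1) + v" "odd r = b" by (auto simp: r_def)
    have "v div (2 * L + 1) = 0" "v mod (2 * L + 1) = v" using e by auto
    then have 2: "r div 2 div (2 * L + 1) = j" "r div 2 mod (2 * L + 1) = v"
      unfolding 1 by (simp_all del: mult_Suc_right add: div_add1_eq)
    have "j * (2 * L + 1) + v < (2 * L + 1) * (2 * L + 1)"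
      using mult_le_mono1[of j "2 * L" "2 * L + 1"] e by simp
    then have "r < 2 * (2 * L + 1) * (2 * L + 1)" unfolding r_def by (cases b; simp)
    moreover have "e = search_edge L r" unfolding search_edge_def Let_def 2 1(2) using e by simp
    ultimately show "e \<in> ?E" by (metis atLeast0LessThan image_eqI lessThan_iff list.set_map set_upt)
  qed
qed

lemma inj_search_edge: "inj_on (search_edge L) X"
proof (rule inj_onI)
  fix r r' assume "search_edge L r = search_edge L r'"
  then have "r div 2 div (2 * L + 1) = r' div 2 div (2 * L + 1)"
    "r div 2 mod (2 * L + 1) = r' div 2 mod (2 * L + 1)" and o: "odd r = odd r'"
    by (auto simp: search_edge_def Let_def)
  then have "r div 2 = r' div 2" by (metis div_mod_decomp)
  then show "r = r'" using o by (metis div_mod_decomp odd_iff_mod_2_eq_one even_iff_mod_2_eq_zero)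
qed

lemma wf_search_bp: "wf_bp (search_bp (2 ^ t))"
proof -
  have "search_label L j < 2 * L" if "j < 2 * L + 1" "0 < L" for j L
  proof (cases "even j")
    case True
    then show ?thesis using that by (auto simp: search_label_def elim!: evenE)
  next
    case False
    then show ?thesis using that by (auto simp: search_label_def elim!: oddE)
  qed
  then have "\<forall>j \<in> set (map (search_label (2 ^ t)) [0..<2 * 2 ^ t + 1]). j < 2 * 2 ^ t" by auto
  moreover have "\<forall>(i, u, v, m) \<in> set (map (search_edge (2 ^ t)) [0..<2 * (2 * 2 ^ t + 1) * (2 * 2 ^ t + 1)]).
      i + 1 < 2 * 2 ^ t + 2 \<and> u < 2 * 2 ^ t + 1 \<and> v < 2 * 2 ^ t + 1"
    unfolding search_edges by (auto simp: less_Suc_eq_le search_target_le)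
  moreover have "distinct (map (search_edge L) [0..<n])" for L n
    by (simp only: distinct_map distinct_upt inj_search_edge simp_thms)
  ultimately show ?thesis
    unfolding wf_bp_def search_bp_def by (simp del: upt_Suc mult_Suc_right add_2_eq_Suc')
qed

section \<open>Runs of the branching program\<close>

primrec search_state :: "nat \<Rightarrow> (nat \<Rightarrow> bool) \<Rightarrow> nat \<Rightarrow> nat" where
  "search_state L x 0 = 0"
| "search_state L x (Suc j) = search_target L j (search_state L x j) (x (search_label L j))"

lemma search_state_le: "j \<le> 2 * 2 ^ t + 1 \<Longrightarrow> search_state (2 ^ t) x j \<le> 2 * 2 ^ t"
  by (induction j) (auto intro!: search_target_le)

lemma search_state_eq_fold:
  assumes "k \<le> L"
  shows "search_state L x (2 * k) = fold (visit (\<lambda>k. \<not> (x k \<and> x (L + k)))) [0..<k] 0"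
  using assms
proof (induction k)
  case (Suc k)
  have l: "search_label L (2 * k) = k" "search_label L (Suc (2 * k)) = L + k"
    by (simp_all add: search_label_def)
  have ne: "2 * k \<noteq> 2 * L" "Suc (2 * k) \<noteq> 2 * L" using Suc.prems by presburger+
  \<comment> \<open>A jump in layer \<open>2 * k\<close> leaves node \<open>k\<close>, so layer
    \<open>2 * k + 1\<close> cannot act a second time.\<close>
  have "next_leaf c k \<noteq> k" for c using next_leaf_gt[of k c] by simp
  then show ?case using Suc ne
    by (cases "fold (visit (\<lambda>k. \<not> (x k \<and> x (L + k)))) [0..<k] 0 = k")
      (auto simp: l search_target_def visit_def[of _ k])
qed simp

lemma search_state_last:
  assumes "0 < L"
  shows "search_state L x (2 * L + 1) = 0 \<longleftrightarrow> search_state L x (2 * L) = L"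
  using assms by (simp add: search_target_def)

text \<open>Every node has exactly one outgoing edge per mark, so on a given input the path is
  forced to be the sequence of the \<open>search_state\<close>.\<close>

lemma search_bp_accepts_iff:
  "bp_accepts (search_bp (2 ^ t)) xs \<longleftrightarrow> search_state (2 ^ t) ((!) xs) (2 * 2 ^ t + 1) = 0"
proof -
  let ?L = "2 ^ t :: nat" and ?x = "(!) xs"
  let ?E = "set (bp_edges (search_bp ?L))"
  have E: "?E = {(j, v, search_target ?L j v b, b) | j v b. j \<le> 2 * ?L \<and> v \<le> 2 * ?L}"
    by (simp only: search_bp_def bp.simps search_edges)
  have lab: "bp_labels (search_bp ?L) ! i = search_label ?L i" if "i < 2 * ?L + 1" for i
    using that by (simp add: search_bp_def del: upt_Suc)
  have len: "bp_length (search_bp ?L) = 2 * ?L + 2" by (simp add: search_bp_def)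
  show ?thesis
  proof
    assume "bp_accepts (search_bp ?L) xs"
    then obtain path where p: "path ! 0 = 0" "path ! (2 * ?L + 1) = 0"
      "\<And>i. i < 2 * ?L + 1 \<Longrightarrow> (i, path ! i, path ! (i + 1), ?x (search_label ?L i)) \<in> ?E"
      unfolding bp_accepts_def len using lab by auto
    have "path ! j = search_state ?L ?x j" if "j \<le> 2 * ?L + 1" for j
      using that
    proof (induction j)
      case (Suc j)
      then show ?case using p(3)[of j] unfolding E by auto
    qed (simp add: p)
    then show "search_state ?L ?x (2 * ?L + 1) = 0" using p by auto
  next
    assume a: "search_state ?L ?x (2 * ?L + 1) = 0"
    let ?p = "map (search_state ?L ?x) [0..<2 * ?L + 2]"
    have nth: "?p ! i = search_state ?L ?x i" if "i < 2 * ?L + 2" for i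
      using that by (metis add_0 diff_zero length_upt nth_map nth_upt)
    show "bp_accepts (search_bp ?L) xs"
      unfolding bp_accepts_def len
    proof (intro exI[of _ ?p] conjI allI impI)
      fix i assume i: "i < 2 * ?L + 2 - 1"
      show "(i, ?p ! i, ?p ! (i + 1), xs ! (bp_labels (search_bp ?L) ! i)) \<in> ?E"
        using i search_state_le[of i t ?x] unfolding E by (simp add: nth lab del: upt_Suc)
    qed (use a in \<open>simp_all add: nth del: upt_Suc search_state.simps(2)\<close>)
  qed
qed

lemma search_bp_correct:
  assumes "even t" "length a = 2 ^ t" "length b = 2 ^ t"
  shows "bp_accepts (search_bp (2 ^ t)) (a @ b) \<longleftrightarrow> \<not> p_alt t a b"
proof -
  let ?f = "foldl (\<lambda>k b. 2 * k + of_bool b) (0::nat)"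
  have lt: "?f i < 2 ^ t" if "length i = t" for i
    using foldl_bits_div[of 0 i] that by (auto simp: div_eq_0_iff)
  have "bp_accepts (search_bp (2 ^ t)) (a @ b) \<longleftrightarrow>
      search_from (\<lambda>k. \<not> ((a @ b) ! k \<and> (a @ b) ! (2 ^ t + k))) (2 ^ t) 0 = 2 ^ t"
    unfolding search_bp_accepts_iff
    using search_state_last[of "2 ^ t" "(!) (a @ b)"] search_state_eq_fold[of "2 ^ t" "2 ^ t" "(!) (a @ b)"]
    by (simp add: search_from_def)
  also have "\<dots> \<longleftrightarrow> alt_ex t (\<lambda>i. \<not> ((a @ b) ! (?f i) \<and> (a @ b) ! (2 ^ t + ?f i)))"
    using search_from_root[OF assms(1)] by simp
  also have "\<dots> \<longleftrightarrow> alt_ex t (\<lambda>i. \<not> (tensor_at a i \<and> tensor_at b i))"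
    using assms lt by (intro alt_cong) (simp add: tensor_at_def nth_append)
  finally show ?thesis by (simp add: p_alt_def not_alt)
qed

section \<open>The program for the reduction to branching programs\<close>

text \<open>Both recursive calls of \<open>next_leaf\<close> halve the number, double the result and
  flip the flag, so the recursion becomes a loop: registers 9, 11 and 12 hold the number, the flag
  and the collected power of 2. The test fails only for a true flag and an even number, where
  \<open>m + 1\<close> remains to be multiplied by that power.\<close>

definition next_leaf_loop :: com where
  "next_leaf_loop =
     While (Sub (Num 1) (Mul (Reg 11) (Sub (Num 1) (Mod (Reg 9) (Num 2)))))
       (seqs [Assign 9 (Div (Reg 9) (Num 2)), Assign 12 (Mul (Num 2) (Reg 12)),
          Assign 11 (Sub (Num 1) (Reg 11))])"

lemma wp_next_leaf_loop:
  assumes "regs s 9 = m" "regs s 11 = of_bool c" "regs s 12 = p" "0 < p"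
    "p * next_leaf c m < 2 ^ w" "0 < w" "2 < (2 :: nat) ^ w"
  shows "wp w inp next_leaf_loop
    (\<lambda>k s'. k \<le> 23 * (2 * m + 1) + 10 \<and> (regs s' 9 + 1) * regs s' 12 = p * next_leaf c m) s"
proof -
  \<comment> \<open>The termination measure of \<open>next_leaf\<close> bounds the iterations. Each
    costs 10 for the test and 13 for the body; the final 10 are the failing test.\<close>
  have "wp w inp next_leaf_loop (\<lambda>k s'. k \<le> 23 * (2 * m + (if c then 0 else 1)) + 10 \<and>
      (regs s' 9 + 1) * regs s' 12 = p * next_leaf c m) s"
    using assms
  proof (induction c m arbitrary: s p rule: next_leaf.induct)
    case (1 m)
    show ?case
    proof (cases "even m")
      case True
      then show ?thesis
        unfolding next_leaf_loop_def using 1(2-)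
        by (intro wp_While_False) (auto simp: next_leaf.simps(1)[of m])
    next
      case False
      have nl: "next_leaf True m = 2 * next_leaf False (m div 2)"
        using False by (simp add: next_leaf.simps(1)[of m])
      have "2 * p \<le> p * next_leaf True m"
        unfolding nl using next_leaf_gt[of "m div 2" False] by simp
      then have p: "2 * p < 2 ^ w" using 1(6) by (rule le_less_trans)
      let ?s = "s\<lparr>regs := (regs s)(9 := m div 2, 12 := 2 * p, 11 := 0)\<rparr>"
      have "wp w inp next_leaf_loop (\<lambda>k s'. k \<le> 23 * (2 * (m div 2) + 1) + 10 \<and>
        (regs s' 9 + 1) * regs s' 12 = 2 * p * next_leaf False (m div 2)) ?s"
        using 1(1)[OF False, of ?s "2 * p"] 1(2-) nl by (simp add: mult_ac)
      then have "wp w inp next_leaf_loop (\<lambda>k s'. 23 + k \<le> 23 * (2 * m) + 10 \<and>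
        (regs s' 9 + 1) * regs s' 12 = p * next_leaf True m) ?s"
        by (rule wp_mono) (use False in \<open>auto simp: nl elim!: oddE\<close>)
      then show ?thesis
        unfolding next_leaf_loop_def using 1(2-) p False
        by (intro wp_While_True) (auto simp: odd_iff_mod_2_eq_one elim!: wp_mono)
    qed
  next
    case (2 m)
    have nl: "next_leaf False m = 2 * next_leaf True (m div 2)"
      by (simp add: next_leaf.simps(2)[of m])
    have "2 * p \<le> p * next_leaf False m"
      unfolding nl using next_leaf_gt[of "m div 2" True] by simp
    then have p: "2 * p < 2 ^ w" using 2(6) by (rule le_less_trans)
    let ?s = "s\<lparr>regs := (regs s)(9 := m div 2, 12 := 2 * p, 11 := 1)\<rparr>"
    have "wp w inp next_leaf_loop (\<lambda>k s'. k \<le> 23 * (2 * (m div 2)) + 10 \<and>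
      (regs s' 9 + 1) * regs s' 12 = 2 * p * next_leaf True (m div 2)) ?s"
      using 2(1)[of ?s "2 * p"] 2(2-) nl by (simp add: mult_ac)
    then have "wp w inp next_leaf_loop (\<lambda>k s'. 23 + k \<le> 23 * (2 * m + 1) + 10 \<and>
      (regs s' 9 + 1) * regs s' 12 = p * next_leaf False m) ?s"
      by (rule wp_mono) (auto simp: nl)
    then show ?case
      unfolding next_leaf_loop_def using 2(2-) p
      by (intro wp_While_True) (auto elim!: wp_mono)
  qed
  then show ?thesis by (rule wp_mono) (auto split: if_splits)
qed

text \<open>Registers 6, 7, 8 and 10 receive layer, node, mark and target of the edge. Subtraction
  is truncated, so mark minus parity of the layer is nonzero only for mark 1 in an even layer, where
  the node has to wait for the second bit.\<close>

definition search_edge_prog :: com where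
  "search_edge_prog = seqs
     [Assign 6 (Div (Div (Reg 5) (Num 2)) (Reg 3)),
      Assign 7 (Mod (Div (Reg 5) (Num 2)) (Reg 3)),
      Assign 8 (Mod (Reg 5) (Num 2)),
      Cond (Equal (Reg 6) (Mul (Num 2) (Reg 2)))
        (Assign 10 (Sub (Num 1) (Equal (Reg 7) (Reg 2))))
        (Cond (Equal (Reg 7) (Div (Reg 6) (Num 2)))
          (Cond (Sub (Reg 8) (Mod (Reg 6) (Num 2)))
            (Assign 10 (Reg 7))
            (seqs
              [Assign 9 (Reg 7), Assign 11 (Sub (Num 1) (Reg 8)), Assign 12 (Num 1),
               next_leaf_loop,
               Assign 10 (Mul (Add (Reg 9) (Num 1)) (Reg 12))]))
          (Assign 10 (Reg 7))),
      Emit (Reg 6), Emit (Reg 7), Emit (Reg 10), Emit (Reg 8)]"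

definition oapt_to_bpsp_prog :: com where
  "oapt_to_bpsp_prog = seqs
     [Assign 0 (Inp (Num 0)), Assign 13 (Inp (Num 1)), Assign 2 (Num 1),
      pow_loop 13 2 2,
      Assign 3 (Add (Mul (Num 2) (Reg 2)) (Num 1)),
      Assign 4 (Mul (Mul (Num 2) (Reg 3)) (Reg 3)),
      Emit (Reg 0), Emit (Mul (Num 2) (Reg 2)), Emit (Add (Reg 3) (Num 1)), Emit (Reg 3),
      Emit (Reg 4),
      for_loop 5 3 (Emit (Add (Mul (Mod (Reg 5) (Num 2)) (Reg 2)) (Div (Reg 5) (Num 2)))),
      for_loop 5 4 search_edge_prog,
      Assign 4 (Mul (Mul (Num 2) (Reg 0)) (Reg 2)),
      for_loop 5 4 (Emit (Inp (Add (Num 2) (Reg 5))))]"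

lemma writes_next_leaf_loop [simp]: "writes next_leaf_loop = {9, 11, 12}" "silent next_leaf_loop"
  by (auto simp: next_leaf_loop_def)

lemma writes_search_edge_prog [simp]: "writes search_edge_prog = {6, 7, 8, 9, 10, 11, 12}"
  by (auto simp: search_edge_prog_def)

lemma wp_search_edge_prog:
  assumes L: "L = 2 ^ t" and w: "0 < w" "2 < (2::nat) ^ w" "2 * L + 1 < 2 ^ w"
    and s: "regs s 2 = L" "regs s 3 = 2 * L + 1" "regs s 5 = r" "r < 2 * (2 * L + 1) * (2 * L + 1)"
  shows "wp w inp search_edge_prog
    (\<lambda>k s'. k \<le> 46 * L + 200 \<and> outp s' = outp s @ enc_edge (search_edge L r)) s"
proof -
  define j where "j = r div 2 div Suc (2 * L)"
  define v where "v = r div 2 mod Suc (2 * L)"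
  have e: "enc_edge (search_edge L r) = [j, v, search_target L j v (odd r), r mod 2]"
    by (auto simp: enc_edge_def search_edge_def j_def v_def Let_def odd_iff_mod_2_eq_one)
  have "r div 2 < Suc (2 * L) * Suc (2 * L)" using s(4) by (auto simp: less_mult_imp_div_less)
  then have j: "j \<le> 2 * L" unfolding j_def by (metis less_Suc_eq_le less_mult_imp_div_less)
  have r2: "r mod 2 = of_bool (odd r)" by (simp add: mod_2_eq_odd)
  show ?thesis
  proof (cases "j \<noteq> 2 * L \<and> v = j div 2 \<and> \<not> (odd r \<and> even j)")
    case False
    then show ?thesis
      unfolding search_edge_prog_def e using w s
      by (auto simp: j_def[symmetric] v_def[symmetric] search_target_def r2 mod_2_eq_odd)
  next
    case True
    then have v: "v < L" using j by auto
    have nl: "next_leaf (even r) v \<le> 2 * L" using next_leaf_le[of v t] v L by simp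
    let ?s = "s\<lparr>regs := (regs s)(6 := j, 7 := v, 8 := r mod 2, 9 := v, 11 := of_bool (even r), 12 := 1)\<rparr>"
    have "wp w inp next_leaf_loop (\<lambda>k s'. k \<le> 46 * v + 33 \<and>
        (regs s' 9 + 1) * regs s' 12 = next_leaf (even r) v) ?s"
      using wp_next_leaf_loop[of ?s v "even r" 1 w inp] nl w by (auto elim!: wp_mono)
    then show ?thesis
      unfolding search_edge_prog_def e using w s True v nl
      by (auto simp: j_def[symmetric] v_def[symmetric] search_target_def r2 mod_2_eq_odd mod_mult_left_eq
          elim!: wp_frame)
  qed
qed

definition oapt_to_bpsp :: "oapt \<Rightarrow> bpsp" where
  "oapt_to_bpsp I =
     \<lparr>bpsp_bp = search_bp (2 ^ oapt_t I), bpsp_A = oapt_A I, bpsp_B = oapt_B I\<rparr>"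

lemma oapt_to_bpsp_correct:
  assumes "oapt_inst I"
  shows "bpsp_inst (oapt_to_bpsp I)" "bpsp_yes (oapt_to_bpsp I) = oapt_yes I"
proof -
  show "bpsp_inst (oapt_to_bpsp I)"
    using assms wf_search_bp by (auto simp: bpsp_inst_def oapt_inst_def oapt_to_bpsp_def search_bp_def)
  show "bpsp_yes (oapt_to_bpsp I) = oapt_yes I"
    using assms search_bp_correct[of "oapt_t I"]
    by (auto simp: bpsp_yes_def oapt_yes_def oapt_to_bpsp_def oapt_inst_def)
qed

text \<open>There are quadratically many edges in \<open>L\<close>, and computing one target may
  take \<open>L\<close> climbing steps, hence the cube; the factor \<open>N\<close> is due to
  copying the rows.\<close>

lemma wp_oapt_to_bpsp_prog:
  assumes I: "oapt_inst I" and inp: "inp = enc_oapt I" and t: "t = oapt_t I"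
    and N: "N = length (oapt_A I)" and L: "L = 2 ^ t"
    and w: "0 < w" "2 < (2::nat) ^ w" "2 * N * L + 2 < 2 ^ w" "2 * (2 * L + 1) * (2 * L + 1) < 2 ^ w"
      "N < 2 ^ w" "t < 2 ^ w"
  shows "wp w inp oapt_to_bpsp_prog
    (\<lambda>k s'. k \<le> 6000 * (N + 1) * L ^ 3 \<and> outp s' = enc_bpsp (oapt_to_bpsp I)) init_state"
proof -
  let ?A = "enc_bits (oapt_A I @ oapt_B I)"
  let ?V = "Suc (2 * L)"
  have inp': "inp = N # t # ?A" by (simp add: inp enc_oapt_def N t enc_bits_def)
  have "sum_list (map length xs) = length xs * 2 ^ t" if "\<forall>x\<in>set xs. length x = 2 ^ t" for xs :: "bool list list"
    using that by (induction xs) auto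
  then have lenA: "length ?A = 2 * N * L"
    using I by (simp add: enc_bits_def length_concat oapt_inst_def N L t)
  have A01: "?A ! r mod 2 ^ w = ?A ! r" if "r < 2 * N * L" for r
  proof -
    have "?A ! r < 2" using that lenA by (simp add: enc_bits_def nth_append)
    then show ?thesis using w(2) by simp
  qed
  have V: "2 * L + 2 < 2 ^ w" "4 * L + 2 < 2 ^ w"
  proof -
    have "4 * L + 2 \<le> 2 * (2 * L + 1) * (2 * L + 1)" by simp
    then show "2 * L + 2 < 2 ^ w" "4 * L + 2 < 2 ^ w" using w(4) L
      by linarith+
  qed
  let ?lab = "Emit (Add (Mul (Mod (Reg 5) (Num 2)) (Reg 2)) (Div (Reg 5) (Num 2)))"
  have labels: "wp w inp (for_loop 5 3 ?lab)
      (\<lambda>k s'. k \<le> ?V * 20 + 6 \<and> outp s' = outp s @ map (search_label L) [0..<?V] \<and>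
        (\<forall>r. r \<noteq> 5 \<longrightarrow> regs s' r = regs s r)) s"
    if "regs s 2 = L" "regs s 3 = ?V" for s
  proof -
    have "wp w inp (for_loop 5 3 ?lab)
      (\<lambda>k s'. k \<le> ?V * (12 + 8) + 6 \<and>
        outp s' = outp s @ concat (map (\<lambda>j. [search_label L j]) [0..<?V]) \<and>
        (\<forall>r. r \<notin> insert 5 (writes ?lab) \<longrightarrow> regs s' r = regs s r)) s"
    proof (rule wp_for_loop)
      fix j and s' :: ram_state
      assume j: "j < ?V" "regs s' 5 = j"
        "\<forall>r. r \<notin> insert 5 (writes ?lab) \<longrightarrow> regs s' r = regs s r"
      have "j mod 2 * L + j div 2 < 2 ^ w" "j mod 2 * L < 2 ^ w"
        using j V by (cases "even j"; auto simp: mod_2_eq_odd)+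
      then show "wp w inp ?lab
          (\<lambda>k s''. k \<le> 12 \<and> outp s'' = outp s' @ [search_label L j]) s'"
        using j that w by (simp add: search_label_def)
    qed (use that w V in auto)
    then show ?thesis by (simp del: upt_Suc)
  qed
  have edges: "wp w inp (for_loop 5 4 search_edge_prog)
      (\<lambda>k s'. k \<le> 2 * ?V * ?V * (46 * L + 200 + 8) + 6 \<and>
        outp s' = outp s @ concat (map (\<lambda>r. enc_edge (search_edge L r)) [0..<2 * ?V * ?V]) \<and>
        regs s' 0 = regs s 0 \<and> regs s' 2 = regs s 2) s"
    if "regs s 2 = L" "regs s 3 = ?V" "regs s 4 = 2 * ?V * ?V" for s
  proof -
    have "wp w inp (for_loop 5 4 search_edge_prog)
      (\<lambda>k s'. k \<le> 2 * ?V * ?V * (46 * L + 200 + 8) + 6 \<and>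
        outp s' = outp s @ concat (map (\<lambda>r. enc_edge (search_edge L r)) [0..<2 * ?V * ?V]) \<and>
        (\<forall>r. r \<notin> insert 5 (writes search_edge_prog) \<longrightarrow> regs s' r = regs s r)) s"
    proof (rule wp_for_loop)
      fix j and s' :: ram_state
      assume j: "j < 2 * ?V * ?V" "regs s' 5 = j"
        "\<forall>r. r \<notin> insert 5 (writes search_edge_prog) \<longrightarrow> regs s' r = regs s r"
      show "wp w inp search_edge_prog
          (\<lambda>k s''. k \<le> 46 * L + 200 \<and> outp s'' = outp s' @ enc_edge (search_edge L j)) s'"
        by (rule wp_search_edge_prog[OF L]) (use j w V that in auto)
    qed (use that w in auto)
    then show ?thesis by (rule wp_mono) auto
  qed
  have copy: "wp w inp (for_loop 5 4 (Emit (Inp (Add (Num 2) (Reg 5)))))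
      (\<lambda>k s'. k \<le> 2 * N * L * 20 + 6 \<and> outp s' = outp s @ ?A) s"
    if "regs s 4 = 2 * N * L" for s
  proof -
    have "wp w inp (for_loop 5 4 (Emit (Inp (Add (Num 2) (Reg 5)))))
      (\<lambda>k s'. k \<le> 2 * N * L * (12 + 8) + 6 \<and>
        outp s' = outp s @ concat (map (\<lambda>r. [?A ! r]) [0..<2 * N * L]) \<and>
        (\<forall>r. r \<notin> insert 5 (writes (Emit (Inp (Add (Num 2) (Reg 5))))) \<longrightarrow> regs s' r = regs s r)) s"
      by (rule wp_for_loop) (use that w in \<open>auto simp: inp' lenA A01\<close>)
    moreover have "map ((!) ?A) [0..<2 * N * L] = ?A" using lenA by (metis map_nth)
    ultimately show ?thesis by (elim wp_mono) simp
  qed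
  have pow: "wp w inp (pow_loop 13 2 2) (\<lambda>k s'. k \<le> t * 10 + 2 \<and> regs s' 2 = L) s"
    if "regs s 13 = t" "regs s 2 = 1" for s
  proof -
    have "2 ^ t < (2 :: nat) ^ w" using V(1) L by linarith
    then show ?thesis using wp_pow_loop[of 13 2 s t 2 w inp] that w L by simp
  qed
  have cost: "t * 10 + 2 + (?V * 20 + 6) + (2 * ?V * ?V * (46 * L + 200 + 8) + 6) + (2 * N * L * 20 + 6) + 100
      \<le> 6000 * (N + 1) * L ^ 3"
  proof -
    have "1 \<le> L" "t \<le> L" using L less_exp[of t] by auto
    then have l: "t \<le> L" "1 \<le> L" "L \<le> L * L" "L * L \<le> L * (L * L)" by simp_all
    have "L * N \<le> L * L * (L * N)" using l(2) by simp
    then have "L * N \<le> L * (L * (L * N))" by (simp only: mult.assoc)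
    with l have "t * 10 + (L * (N * 40) + (556 + (L * 1796 + L * (L * 2032))))
        \<le> L * (L * (L * 5632)) + L * (L * (L * (N * 6000)))"
      by linarith
    then show ?thesis by (simp add: power3_eq_cube algebra_simps)
  qed
  have out: "enc_bpsp (oapt_to_bpsp I) = [N, 2 * L, ?V + 1, ?V, 2 * ?V * ?V] @ map (search_label L) [0..<?V] @
      concat (map (\<lambda>r. enc_edge (search_edge L r)) [0..<2 * ?V * ?V]) @ ?A"
    by (simp add: enc_bpsp_def oapt_to_bpsp_def search_bp_def N L t enc_bits_def o_def del: upt_Suc)
  have inp01: "inp ! 0 = N" "inp ! Suc 0 = t" "inp \<noteq> []" "Suc 0 < length inp"
    by (simp_all add: inp')
  show ?thesis
    unfolding oapt_to_bpsp_prog_def out using w V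
    apply (simp add: init_state_def inp01 del: upt_Suc mult_Suc_right)
    apply (rule wp_frame[OF pow])
      apply simp
     apply simp
    apply (simp add: mod_mult_left_eq del: upt_Suc mult_Suc_right)
    apply (rule wp_frame[OF labels])
      apply simp
     apply simp
    apply (rule wp_frame[OF edges])
       apply simp
      apply simp
     apply simp
    apply (rule wp_frame[OF copy])
     apply (simp add: mod_mult_left_eq)
    using cost
    apply (simp add: mod_mult_left_eq del: upt_Suc mult_Suc_right)
    done
qed

section \<open>Savitch's recursion as an alternating formula\<close>

primrec savitch :: "('a \<Rightarrow> 'a \<Rightarrow> bool) \<Rightarrow> 'a set \<Rightarrow> nat \<Rightarrow> 'a \<Rightarrow> 'a \<Rightarrow> bool" where
  "savitch R V 0 p q = R p q"
| "savitch R V (Suc k) p q = (\<exists>g\<in>V. savitch R V k p g \<and> savitch R V k g q)"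

lemma savitch_imp_rtranclp: "savitch R V k p q \<Longrightarrow> R\<^sup>*\<^sup>* p q"
  by (induction k arbitrary: p q) (auto intro: rtranclp_trans)

lemma savitch_path:
  assumes "\<And>i. f i \<in> V" "\<And>i. R (f i) (f (Suc i))"
  shows "savitch R V k (f a) (f (a + 2 ^ k))"
proof (induction k arbitrary: a)
  case 0
  then show ?case using assms by simp
next
  case (Suc k)
  have "savitch R V k (f a) (f (a + 2 ^ k))" "savitch R V k (f (a + 2 ^ k)) (f (a + 2 ^ k + 2 ^ k))"
    using Suc by blast+
  then show ?case using assms(1) by (auto simp: mult_2 add.assoc)
qed

text \<open>
  The graph on which the recursion runs has the edges of the branching program as vertices
  \<open>1, \<dots>, bp_size P\<close>, a source 0 and a sink \<open>bp_size P + 1\<close>. Using edges instead of nodes avoids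
  any dependence on the width, which is not bounded by the size.
\<close>

definition edge_out :: "bp \<Rightarrow> nat \<Rightarrow> nat \<times> nat" where
  "edge_out P p = (if p = 0 then (0, 0) else case bp_edges P ! (p - 1) of (i, u, v, m) \<Rightarrow> (i + 1, v))"

definition edge_in :: "bp \<Rightarrow> nat \<Rightarrow> nat \<times> nat" where
  "edge_in P q = (if q = bp_size P + 1 then (bp_length P - 1, 0)
     else case bp_edges P ! (q - 1) of (i, u, v, m) \<Rightarrow> (i, u))"

definition edges_join :: "bp \<Rightarrow> nat \<Rightarrow> nat \<Rightarrow> bool" where
  "edges_join P p q \<longleftrightarrow> p \<le> bp_size P \<and> 0 < q \<and> q \<le> bp_size P + 1 \<and> edge_out P p = edge_in P q"

definition edge_label :: "bp \<Rightarrow> nat \<Rightarrow> nat" where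
  "edge_label P q = bp_labels P ! fst (bp_edges P ! (q - 1))"

definition edge_mark :: "bp \<Rightarrow> nat \<Rightarrow> bool" where
  "edge_mark P q = snd (snd (snd (bp_edges P ! (q - 1))))"

text \<open>The disjunct \<open>p = q\<close> allows waiting, so that exactly \<open>2 ^ m\<close>
  steps also cover all shorter paths.\<close>

definition edge_step :: "bp \<Rightarrow> bool list \<Rightarrow> nat \<Rightarrow> nat \<Rightarrow> bool" where
  "edge_step P x p q \<longleftrightarrow> p = q \<or> edges_join P p q \<and>
     (q = bp_size P + 1 \<or> x ! edge_label P q = edge_mark P q)"

section \<open>Accepting paths as walks on edges\<close>

definition bp_walk :: "bp \<Rightarrow> bool list \<Rightarrow> nat \<Rightarrow> nat \<Rightarrow> bool" where
  "bp_walk P x n v \<longleftrightarrow> (\<exists>path. length path = Suc n \<and> path ! 0 = 0 \<and> path ! n = v \<and>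
     (\<forall>i < n. (i, path ! i, path ! (i + 1), x ! (bp_labels P ! i)) \<in> set (bp_edges P)))"

lemma bp_accepts_walk:
  assumes "wf_bp P"
  shows "bp_accepts P x \<longleftrightarrow> bp_walk P x (bp_length P - 1) 0"
proof -
  have "bp_length P = Suc (bp_length P - 1)" using assms by (simp add: wf_bp_def)
  then show ?thesis unfolding bp_accepts_def bp_walk_def by metis
qed

lemma bp_walk_Suc:
  assumes "bp_walk P x n u" "(n, u, v, x ! (bp_labels P ! n)) \<in> set (bp_edges P)"
  shows "bp_walk P x (Suc n) v"
proof -
  obtain path where p: "length path = Suc n" "path ! 0 = 0" "path ! n = u"
    "\<And>i. i < n \<Longrightarrow> (i, path ! i, path ! (i + 1), x ! (bp_labels P ! i)) \<in> set (bp_edges P)"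
    using assms unfolding bp_walk_def by blast
  show ?thesis unfolding bp_walk_def
    by (rule exI[of _ "path @ [v]"]) (use p assms in \<open>auto simp: nth_append less_Suc_eq\<close>)
qed

text \<open>Layers need no separate bookkeeping: an edge of layer i ends in layer i + 1 and can only
  be joined to an edge starting there, so a chain from the source passes through consecutive
  layers.\<close>

lemma edge_steps_imp_walk:
  assumes "(edge_step P x)\<^sup>*\<^sup>* 0 q"
  shows "(q \<le> bp_size P \<longrightarrow> bp_walk P x (fst (edge_out P q)) (snd (edge_out P q))) \<and>
    (q = bp_size P + 1 \<longrightarrow> bp_walk P x (bp_length P - 1) 0)"
  using assms
proof (induction rule: rtranclp_induct)
  case base
  show ?case by (auto simp: edge_out_def bp_walk_def intro!: exI[of _ "[0]"])
next
  case (step p q)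
  show ?case
  proof (cases "p = q")
    case False
    then have j: "edges_join P p q" and m: "q = bp_size P + 1 \<or> x ! edge_label P q = edge_mark P q"
      using step.hyps(2) by (auto simp: edge_step_def)
    then have w: "bp_walk P x (fst (edge_in P q)) (snd (edge_in P q))"
      using step.IH by (simp add: edges_join_def)
    show ?thesis
    proof (cases "q = bp_size P + 1")
      case True
      then show ?thesis using w by (simp add: edge_in_def)
    next
      case F: False
      obtain i u v m' where e: "bp_edges P ! (q - 1) = (i, u, v, m')" by (metis prod_cases4)
      have "q - 1 < length (bp_edges P)" using F j by (auto simp: edges_join_def bp_size_def)
      then have "(i, u, v, m') \<in> set (bp_edges P)" using e by (metis nth_mem)
      then have "bp_walk P x (Suc i) v"
        using w m F j e by (intro bp_walk_Suc[of P x i u]) (auto simp: edge_in_def edge_label_def edge_mark_def)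
      then show ?thesis using F j e by (auto simp: edge_out_def edges_join_def)
    qed
  qed (use step.IH in simp)
qed

lemma savitch_iff_accepts:
  assumes P: "wf_bp P" and M: "bp_size P + 2 \<le> 2 ^ m"
  shows "savitch (edge_step P x) {..<2 ^ m} m 0 (bp_size P + 1) \<longleftrightarrow> bp_accepts P x"
proof
  assume "savitch (edge_step P x) {..<2 ^ m} m 0 (bp_size P + 1)"
  then show "bp_accepts P x"
    using edge_steps_imp_walk[OF savitch_imp_rtranclp] bp_accepts_walk[OF P] by auto
next
  let ?T = "bp_length P" and ?E = "bp_size P"
  assume "bp_accepts P x"
  then obtain path where p: "path ! 0 = 0" "path ! (?T - 1) = 0"
    "\<And>i. i < ?T - 1 \<Longrightarrow> (i, path ! i, path ! (i + 1), x ! (bp_labels P ! i)) \<in> set (bp_edges P)"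
    unfolding bp_accepts_def by blast
  let ?e = "\<lambda>i. (i, path ! i, path ! (i + 1), x ! (bp_labels P ! i))"
  have "\<forall>i. \<exists>j. i < ?T - 1 \<longrightarrow> j < ?E \<and> bp_edges P ! j = ?e i"
    using p(3) by (metis bp_size_def in_set_conv_nth)
  then obtain idx where idx: "\<And>i. i < ?T - 1 \<Longrightarrow> idx i < ?E" "\<And>i. i < ?T - 1 \<Longrightarrow> bp_edges P ! idx i = ?e i"
    by metis
  \<comment> \<open>The edges of an accepting path lie in different layers and are therefore
    distinct, so an accepting path bounds the length of the program by its size.\<close>
  have "inj_on idx {..<?T - 1}" using idx by (metis (no_types, lifting) inj_onI lessThan_iff prod.inject)
  then have T: "?T - 1 \<le> ?E" using idx(1) card_inj_on_le[of idx "{..<?T - 1}" "{..<?E}"] by auto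
  \<comment> \<open>The path as an infinite sequence of vertices: the source at time 0, then the
    edges in order, and from time \<open>bp_length P\<close> on the sink, where it waits.\<close>
  define f where "f i = (if i = 0 then 0 else if i < ?T then Suc (idx (i - 1)) else ?E + 1)" for i
  have T1: "1 \<le> ?T" using P by (simp add: wf_bp_def)
  have "edge_step P x (f i) (f (Suc i))" for i
  proof (cases "i < ?T")
    case i: True
    have out: "f i \<le> ?E" "edge_out P (f i) = (i, path ! i)"
      using i idx[of "i - 1"] p(1) T1 by (auto simp: f_def edge_out_def Suc_le_eq)
    show ?thesis
    proof (cases "Suc i < ?T")
      case True
      then have "i < ?T - 1" by simp
      then show ?thesis using idx[of i] out True
        by (auto simp: edge_step_def edges_join_def edge_in_def edge_label_def edge_mark_def f_def[of "Suc i"])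
    next
      case False
      then have "?T - 1 = i" "f (Suc i) = ?E + 1" using i by (auto simp: f_def)
      then show ?thesis using out p(2)
        by (simp add: edge_step_def edges_join_def edge_in_def)
    qed
  next
    case False
    then show ?thesis using T1 by (auto simp: f_def edge_step_def)
  qed
  moreover have "f i \<in> {..<2 ^ m}" for i
  proof -
    have "f i \<le> ?E + 1" using idx(1)[of "i - 1"] by (auto simp: f_def Suc_le_eq less_SucI)
    then show ?thesis using M by simp
  qed
  ultimately have "savitch (edge_step P x) {..<2 ^ m} m (f 0) (f (0 + 2 ^ m))"
    by (intro savitch_path)
  moreover have "f (0 + 2 ^ m) = ?E + 1"
  proof -
    have "\<not> 2 ^ m < ?T" using T M by linarith
    then show ?thesis by (simp add: f_def)
  qed
  ultimately show "savitch (edge_step P x) {..<2 ^ m} m 0 (?E + 1)" by (simp add: f_def)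
qed

text \<open>
  A state \<open>(p, q, g, c)\<close> consists of the current end points, and of the \<open>c\<close> bits guessed so far
  of the middle vertex \<open>g\<close>. A round reads the base-4 digit made of an existential and a universal
  bit; the universal bit only matters when \<open>g\<close> is complete.
\<close>

fun round_step :: "nat \<Rightarrow> nat \<times> nat \<times> nat \<times> nat \<Rightarrow> nat \<Rightarrow> nat \<times> nat \<times> nat \<times> nat" where
  "round_step m (p, q, g, c) d =
     (if c + 1 = m
      then if odd d then (2 * g + d div 2, q, 0, 0) else (p, 2 * g + d div 2, 0, 0)
      else (p, q, 2 * g + d div 2, c + 1))"

primrec rounds :: "nat \<Rightarrow> nat \<Rightarrow> nat \<Rightarrow> nat \<times> nat \<times> nat \<times> nat \<Rightarrow> nat \<times> nat \<times> nat \<times> nat" where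
  "rounds m 0 x \<sigma> = \<sigma>"
| "rounds m (Suc r) x \<sigma> = rounds m r x (round_step m \<sigma> (x div 4 ^ r mod 4))"

section \<open>Savitch's recursion as a game on bits\<close>

primrec game :: "(nat \<times> nat \<times> nat \<times> nat \<Rightarrow> bool) \<Rightarrow> nat \<Rightarrow> nat \<Rightarrow> nat \<times> nat \<times> nat \<times> nat \<Rightarrow> bool" where
  "game G m 0 \<sigma> = G \<sigma>"
| "game G m (Suc r) \<sigma> = (\<exists>e. \<forall>h. game G m r (round_step m \<sigma> (2 * of_bool e + of_bool h)))"

text \<open>The induction moves two bits at a time from the quantifiers into \<open>a\<close>. What
  is in \<open>a\<close> already does not matter, since \<open>rounds m r\<close> reads only the
  lowest \<open>r\<close> base-4 digits, the most significant of them first.\<close>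

lemma alt_ex_game:
  "alt_ex (2 * r) (\<lambda>i. G (rounds m r (foldl (\<lambda>k b. 2 * k + of_bool b) a i) \<sigma>)) = game G m r \<sigma>"
proof (induction r arbitrary: a \<sigma>)
  case (Suc r)
  let ?f = "foldl (\<lambda>k b. 2 * k + of_bool b) :: nat \<Rightarrow> bool list \<Rightarrow> nat"
  have "alt_ex (2 * r) (\<lambda>i. G (rounds m (Suc r) (?f (2 * (2 * a + of_bool e) + of_bool h) i) \<sigma>)) =
      game G m r (round_step m \<sigma> (2 * of_bool e + of_bool h))" for e h
  proof -
    have "?f (2 * (2 * a + of_bool e) + of_bool h) i div 4 ^ r mod 4 = 2 * of_bool e + of_bool h"
      if "length i = 2 * r" for i
    proof -
      have "?f (2 * (2 * a + of_bool e) + of_bool h) i div 4 ^ r = 2 * (2 * a + of_bool e) + of_bool h"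
        using foldl_bits_div[of "2 * (2 * a + of_bool e) + of_bool h" i] that by (simp add: power_mult)
      also have "\<dots> mod 4 = 2 * of_bool e + of_bool h" by (cases e; cases h; simp; presburger)
      finally show ?thesis .
    qed
    then show ?thesis unfolding Suc[symmetric, of _ "2 * (2 * a + of_bool e) + of_bool h"]
      by (intro alt_cong) simp
  qed
  then show ?case by simp
qed simp

text \<open>Only the last of the \<open>Suc d\<close> rounds uses its universal bit. So the
  existential bits together guess the remaining part \<open>y\<close> of the middle vertex, and the
  last universal bit demands both halves.\<close>

lemma game_level:
  assumes "c + Suc d = m"
  shows "game G m (Suc d + r) (p, q, g, c) \<longleftrightarrow>
    (\<exists>y < 2 ^ Suc d. game G m r (p, g * 2 ^ Suc d + y, 0, 0) \<and> game G m r (g * 2 ^ Suc d + y, q, 0, 0))"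
  using assms
proof (induction d arbitrary: g c)
  case 0
  have "(\<exists>y < 2. Q y) \<longleftrightarrow> Q 0 \<or> Q 1" for Q :: "nat \<Rightarrow> bool"
    by (auto simp: less_2_cases_iff)
  then show ?case using 0 by (auto simp: all_bool_eq ex_bool_eq mult.commute)
next
  case (Suc d)
  \<comment> \<open>The leading bit of \<open>y\<close> is split off, since this is the one guessed
    first.\<close>
  have split: "(\<exists>y < 2 ^ Suc (Suc d). Q y) \<longleftrightarrow> (\<exists>e. \<exists>y < 2 ^ Suc d. Q (of_bool e * 2 ^ Suc d + y))" for Q :: "nat \<Rightarrow> bool"
  proof
    assume "\<exists>y < 2 ^ Suc (Suc d). Q y"
    then obtain y where y: "y < 2 ^ Suc (Suc d)" "Q y" by blast
    show "\<exists>e. \<exists>y < 2 ^ Suc d. Q (of_bool e * 2 ^ Suc d + y)"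
    proof (cases "y < 2 ^ Suc d")
      case True
      then show ?thesis using y by (intro exI[of _ False]) auto
    next
      case False
      then show ?thesis using y by (intro exI[of _ True] exI[of _ "y - 2 ^ Suc d"]) auto
    qed
  next
    assume "\<exists>e. \<exists>y < 2 ^ Suc d. Q (of_bool e * 2 ^ Suc d + y)"
    then obtain e y where "y < 2 ^ Suc d" "Q (of_bool e * 2 ^ Suc d + y)" by blast
    then show "\<exists>y < 2 ^ Suc (Suc d). Q y"
      by (intro exI[of _ "of_bool e * 2 ^ Suc d + y"]) (cases e; simp)
  qed
  have "game G m (Suc (Suc d) + r) (p, q, g, c) \<longleftrightarrow> (\<exists>e. game G m (Suc d + r) (p, q, 2 * g + of_bool e, c + 1))"
    using Suc.prems by (auto simp: all_bool_eq ex_bool_eq)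
  also have "\<dots> \<longleftrightarrow> (\<exists>e. \<exists>y < 2 ^ Suc d. game G m r (p, (2 * g + of_bool e) * 2 ^ Suc d + y, 0, 0) \<and>
      game G m r ((2 * g + of_bool e) * 2 ^ Suc d + y, q, 0, 0))"
    using Suc.IH[of "c + 1"] Suc.prems by simp
  also have "\<dots> \<longleftrightarrow> (\<exists>y < 2 ^ Suc (Suc d). game G m r (p, g * 2 ^ Suc (Suc d) + y, 0, 0) \<and>
      game G m r (g * 2 ^ Suc (Suc d) + y, q, 0, 0))"
    unfolding split by (simp add: algebra_simps)
  finally show ?case .
qed

lemma game_savitch:
  assumes "0 < m" "\<And>p q. G (p, q, 0, 0) = R p q"
  shows "game G m (k * m) (p, q, 0, 0) = savitch R {..<2 ^ m} k p q"
proof (induction k arbitrary: p q)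
  case (Suc k)
  have "game G m (Suc (m - 1) + k * m) (p, q, 0, 0) = savitch R {..<2 ^ m} (Suc k) p q"
    using game_level[of 0 "m - 1" m G "k * m" p q 0] assms Suc by (auto simp: Bex_def)
  then show ?case using assms(1) by simp
qed (use assms in simp)

section \<open>The tensors and their alternating product\<close>

definition row_ok :: "bp \<Rightarrow> bool \<Rightarrow> bool list \<Rightarrow> nat \<Rightarrow> nat \<Rightarrow> bool" where
  "row_ok P side row p q \<longleftrightarrow> p = q \<or> edges_join P p q \<and> (q = bp_size P + 1 \<or>
     (edge_label P q < bp_inputs P div 2 \<longleftrightarrow> side) \<and>
     row ! (if side then edge_label P q else edge_label P q - bp_inputs P div 2) = edge_mark P q)"

text \<open>A step that reads an input bit is confirmed only by the side that owns the bit, any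
  other valid step by both sides. The tensors store the negations, so the conjunction of two entries
  negates this disjunction.\<close>

lemma edge_step_rows:
  assumes "length a = bp_inputs P div 2"
  shows "edge_step P (a @ b) p q \<longleftrightarrow> row_ok P True a p q \<or> row_ok P False b p q"
  using assms by (auto simp: edge_step_def row_ok_def nth_append)

text \<open>
  The leading two bits 10 lead to a block of ones, which makes the block with the leading bits 11
  irrelevant. The latter stores the binary representation of \<open>z\<close>, to keep the tensors distinct.
\<close>

definition savitch_entry :: "bp \<Rightarrow> nat \<Rightarrow> bool \<Rightarrow> bool list \<Rightarrow> nat \<Rightarrow> nat \<Rightarrow> bool" where
  "savitch_entry P m side row z pos =
     (if pos div 4 ^ (m * m) = 2 then True
      else if pos div 4 ^ (m * m) = 3 then odd (z div 2 ^ (pos mod 4 ^ (m * m)))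
      else case rounds m (m * m) pos (0, bp_size P + 1, 0, 0) of (p, q, g, c) \<Rightarrow> \<not> row_ok P side row p q)"

definition savitch_tensor :: "bp \<Rightarrow> nat \<Rightarrow> bool \<Rightarrow> bool list \<Rightarrow> nat \<Rightarrow> tensor" where
  "savitch_tensor P m side row z = map (savitch_entry P m side row z) [0..<4 * 4 ^ (m * m)]"

lemma alt_ex_False: "\<not> alt_ex t (\<lambda>_. False)" "\<not> alt_all t (\<lambda>_. False)"
  by (induction t) auto

lemma savitch_tensor_correct:
  assumes P: "wf_bp P" and m: "bp_size P + 2 \<le> 2 ^ m" and a: "length a = bp_inputs P div 2"
  shows "p_alt (2 * (m * m + 1)) (savitch_tensor P m True a z) (savitch_tensor P m False b z') \<longleftrightarrow>
    \<not> bp_accepts P (a @ b)"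
proof -
  let ?f = "foldl (\<lambda>k b. 2 * k + of_bool b) :: nat \<Rightarrow> bool list \<Rightarrow> nat" and ?Q = "m * m"
  let ?u = "savitch_entry P m True a z" and ?v = "savitch_entry P m False b z'"
  have m0: "0 < m" using m by (cases m) auto
  have S: "4 * 4 ^ ?Q = (2 :: nat) ^ (2 * (?Q + 1))" by (simp add: power_mult power_add power2_eq_square)
  have lt: "?f 0 i < 4 * 4 ^ ?Q" if "length i = 2 * (?Q + 1)" for i
    using foldl_bits_div[of 0 i] unfolding S that[symmetric] by (auto simp: div_eq_0_iff)
  define G where "G = (\<lambda>(p, q, g :: nat, c :: nat). edge_step P (a @ b) p q)"
  have div: "?f k i div 4 ^ ?Q = k" if "length i = 2 * ?Q" for k i
    using foldl_bits_div[of k i] that by (simp add: power_mult)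
  \<comment> \<open>The blocks 00 and 01 contain the same game, because \<open>rounds\<close>
    ignores the digit in front of the lowest \<open>m * m\<close> ones.\<close>
  have main: "alt_ex (2 * ?Q) (\<lambda>i. \<not> (?u (?f k i) \<and> ?v (?f k i))) \<longleftrightarrow> bp_accepts P (a @ b)"
    if k: "k < 2" for k
  proof -
    have "alt_ex (2 * ?Q) (\<lambda>i. \<not> (?u (?f k i) \<and> ?v (?f k i))) \<longleftrightarrow>
        alt_ex (2 * ?Q) (\<lambda>i. G (rounds m ?Q (?f k i) (0, bp_size P + 1, 0, 0)))"
    proof (rule alt_cong)
      fix i :: "bool list" assume "length i = 2 * ?Q"
      then have "?f k i div 4 ^ ?Q \<noteq> 2" "?f k i div 4 ^ ?Q \<noteq> 3" using div k by auto
      then show "(\<not> (?u (?f k i) \<and> ?v (?f k i))) = G (rounds m ?Q (?f k i) (0, bp_size P + 1, 0, 0))"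
        by (auto simp: savitch_entry_def G_def edge_step_rows[OF a] split: prod.split)
    qed
    also have "\<dots> \<longleftrightarrow> game G m ?Q (0, bp_size P + 1, 0, 0)" by (rule alt_ex_game)
    also have "\<dots> \<longleftrightarrow> savitch (edge_step P (a @ b)) {..<2 ^ m} m 0 (bp_size P + 1)"
      by (rule game_savitch[OF m0]) (simp add: G_def)
    also have "\<dots> \<longleftrightarrow> bp_accepts P (a @ b)" by (rule savitch_iff_accepts[OF P m])
    finally show ?thesis .
  qed
  have ones: "\<not> alt_ex (2 * ?Q) (\<lambda>i. \<not> (?u (?f 2 i) \<and> ?v (?f 2 i)))"
  proof -
    have "alt_ex (2 * ?Q) (\<lambda>i. \<not> (?u (?f 2 i) \<and> ?v (?f 2 i))) \<longleftrightarrow> alt_ex (2 * ?Q) (\<lambda>_. False)"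
      by (rule alt_cong) (auto simp: savitch_entry_def div)
    then show ?thesis by (simp add: alt_ex_False)
  qed
  have "\<not> p_alt (2 * (?Q + 1)) (savitch_tensor P m True a z) (savitch_tensor P m False b z') \<longleftrightarrow>
      alt_ex (2 * (?Q + 1)) (\<lambda>i. \<not> (?u (?f 0 i) \<and> ?v (?f 0 i)))"
    unfolding p_alt_def not_alt using lt
    by (intro alt_cong) (simp add: tensor_at_def savitch_tensor_def)
  \<comment> \<open>In the negation the first bit is existential and the second universal: choosing
    1 fails at the block of ones, and choosing 0 leads to the game in both blocks.\<close>
  also have "\<dots> \<longleftrightarrow> bp_accepts P (a @ b)"
    using main[of 0] main[of 1] ones by (auto simp: all_bool_eq ex_bool_eq)
  finally show ?thesis by blast
qed

text \<open>The row number is read back bit by bit from the block 11; the bounds say that all its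
  bits fit there.\<close>

lemma savitch_tensor_inj:
  assumes "savitch_tensor P m side row z = savitch_tensor P m side' row' z'"
    and "z < 2 ^ (4 ^ (m * m))" "z' < 2 ^ (4 ^ (m * m))"
  shows "z = z'"
proof (rule bit_eqI)
  fix n
  let ?Q = "4 ^ (m * m) :: nat"
  show "bit z n = bit z' n"
  proof (cases "n < ?Q")
    case True
    then have d: "(3 * ?Q + n) div ?Q = 3" "(3 * ?Q + n) mod ?Q = n" "3 * ?Q + n < 4 * ?Q" by simp_all
    have "savitch_entry P m side row z (3 * ?Q + n) = savitch_entry P m side' row' z' (3 * ?Q + n)"
      using assms(1) d(3) unfolding savitch_tensor_def by (simp add: list_eq_iff_nth_eq)
    then show ?thesis using True by (simp add: savitch_entry_def d bit_iff_odd)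
  next
    case False
    then have "2 ^ ?Q \<le> (2 :: nat) ^ n" by (intro power_increasing) auto
    then have "z < 2 ^ n" "z' < 2 ^ n" using assms(2,3) by linarith+
    then show ?thesis by (simp add: bit_iff_odd)
  qed
qed

section \<open>The program for the reduction to tensors\<close>

lemma nth_concat_uniform:
  assumes "\<forall>x\<in>set xs. length x = k" "j < length xs" "l < k"
  shows "concat xs ! (j * k + l) = xs ! j ! l"
  using assms
proof (induction xs arbitrary: j)
  case (Cons x xs)
  then show ?case by (cases j) (auto simp: nth_append)
qed simp

lemma length_concat_uniform:
  assumes "\<forall>x\<in>set xs. length x = k"
  shows "length (concat xs) = length xs * k"
  using assms by (induction xs) auto

text \<open>Words that can hold the length and all entries of the input ensure that no address into
  it wraps around and that every cell is read unchanged.\<close>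

locale bpsp_input =
  fixes I :: bpsp and w :: nat
  assumes inst: "bpsp_inst I"
    and entries: "x \<in> set (enc_bpsp I) \<Longrightarrow> x < 2 ^ w"
    and len_lt: "length (enc_bpsp I) < 2 ^ w"
begin

abbreviation "inp \<equiv> enc_bpsp I"
abbreviation "P \<equiv> bpsp_bp I"
abbreviation "N \<equiv> length (bpsp_A I)"
definition h :: nat where "h = bp_inputs (bpsp_bp I) div 2"
abbreviation "E \<equiv> bp_size (bpsp_bp I)"
abbreviation "T \<equiv> bp_length (bpsp_bp I)"
abbreviation "rows \<equiv> bpsp_A I @ bpsp_B I"

lemma wf: "wf_bp P" and T_pos: "1 \<le> T"
  using inst by (auto simp: bpsp_inst_def wf_bp_def)

lemma rows: "length rows = 2 * N" "\<forall>x\<in>set rows. length x = h"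
  using inst by (auto simp: bpsp_inst_def h_def)

lemma inp_eq:
  "inp = ([N, bp_inputs P, T, bp_width P, E] @ bp_labels P) @
     concat (map enc_edge (bp_edges P)) @ map of_bool (concat rows)"
  by (simp add: enc_bpsp_def enc_bits_def bp_size_def)

text \<open>There are 5 header cells and \<open>T - 1\<close> labels, which gives the offset
  \<open>T + 4\<close> of the first edge.\<close>

lemma length_prefix: "length ([N, bp_inputs P, T, bp_width P, E] @ bp_labels P) = T + 4"
  using wf by (auto simp: wf_bp_def)

lemma enc_edges: "\<forall>x\<in>set (map enc_edge (bp_edges P)). length x = 4"
  by (auto simp: enc_edge_def)

lemma length_inp: "length inp = T + 4 + 4 * E + 2 * N * h"
  unfolding inp_eq length_append[of _ "_ @ _"] length_prefix
  using length_concat_uniform[OF enc_edges] length_concat_uniform[OF rows(2)] rows(1)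
  by (simp add: bp_size_def)

lemma inp_mod: "i < length inp \<Longrightarrow> inp ! i mod 2 ^ w = inp ! i"
  by (simp add: entries)

lemma inp_header: "inp ! 0 = N" "inp ! Suc 0 = bp_inputs P" "inp ! 2 = T" "inp ! 4 = E"
  by (simp_all add: inp_eq nth_Cons')

lemma inp_label: "i + 1 < T \<Longrightarrow> inp ! (5 + i) = bp_labels P ! i"
  unfolding inp_eq nth_append[of "_ @ _" "_ @ _"] length_prefix by (simp add: nth_append)

lemma inp_edge:
  assumes "j < E" "bp_edges P ! j = (i, u, v, b)"
  shows "inp ! (T + 4 + 4 * j) = i" "inp ! (T + 4 + 4 * j + 1) = u" "inp ! (T + 4 + 4 * j + 2) = v"
    "inp ! (T + 4 + 4 * j + 3) = of_bool b"
proof -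
  have "inp ! (T + 4 + 4 * j + l) = enc_edge (bp_edges P ! j) ! l" if "l < 4" for l
  proof -
    have lt: "j * 4 + l < length (concat (map enc_edge (bp_edges P)))"
      using that assms(1) unfolding length_concat_uniform[OF enc_edges] by (simp add: bp_size_def)
    have "inp ! (T + 4 + (j * 4 + l)) = concat (map enc_edge (bp_edges P)) ! (j * 4 + l)"
      unfolding inp_eq nth_append[of "_ @ _" "_ @ _"] length_prefix using lt by (simp add: nth_append)
    also have "\<dots> = enc_edge (bp_edges P ! j) ! l"
      using nth_concat_uniform[OF enc_edges _ that] assms(1) by (simp add: bp_size_def)
    finally show ?thesis by (simp add: algebra_simps)
  qed
  from this[of 0] this[of 1] this[of 2] this[of 3] assms(2)
  show "inp ! (T + 4 + 4 * j) = i" "inp ! (T + 4 + 4 * j + 1) = u" "inp ! (T + 4 + 4 * j + 2) = v"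
    "inp ! (T + 4 + 4 * j + 3) = of_bool b"
    by (simp_all add: enc_edge_def)
qed

lemma inp_row:
  assumes "z < 2 * N" "l < h"
  shows "inp ! (T + 4 + 4 * E + (z * h + l)) = of_bool (rows ! z ! l)"
    "T + 4 + 4 * E + (z * h + l) < length inp"
proof -
  have "z * h + l < Suc z * h" using assms by simp
  also have "\<dots> \<le> 2 * N * h" using assms by (intro mult_le_mono) auto
  finally have lt: "z * h + l < 2 * N * h" .
  then show "T + 4 + 4 * E + (z * h + l) < length inp" by (simp add: length_inp)
  have "inp ! (T + 4 + 4 * E + (z * h + l)) = map of_bool (concat rows) ! (z * h + l)"
    unfolding inp_eq nth_append[of "_ @ _" "_ @ _"] length_prefix
    using length_concat_uniform[OF enc_edges] by (simp add: nth_append bp_size_def)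
  also have "\<dots> = of_bool (concat rows ! (z * h + l))"
    using lt length_concat_uniform[OF rows(2)] unfolding rows(1) by (intro nth_map) simp
  finally show "inp ! (T + 4 + 4 * E + (z * h + l)) = of_bool (rows ! z ! l)"
    using nth_concat_uniform[OF rows(2), of z l] assms rows(1) by simp
qed

lemma edge_wf:
  assumes "j < E" "bp_edges P ! j = (i, u, v, b)"
  shows "i + 1 < T" "bp_labels P ! i < 2 * h"
proof -
  have "(i, u, v, b) \<in> set (bp_edges P)" using assms by (metis bp_size_def nth_mem)
  then show "i + 1 < T" using wf by (auto simp: wf_bp_def)
  then have "bp_labels P ! i < bp_inputs P" using wf by (auto simp: wf_bp_def)
  then show "bp_labels P ! i < 2 * h" using inst by (auto simp: bpsp_inst_def h_def)
qed

text \<open>The header alone has 5 cells, so \<open>w\<close> is at least 3, and the small constants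
  of the program fit into a word.\<close>

lemma w_gt: "5 \<le> length inp" "0 < w" "8 \<le> (2::nat) ^ w"
proof -
  show l: "5 \<le> length inp" using T_pos by (simp add: length_inp)
  then have "5 < (2::nat) ^ w" using len_lt by linarith
  then have "(2::nat) ^ 2 < 2 ^ w" by simp
  then have "2 < w" by (rule power_less_imp_less_exp[rotated]) simp
  then have "(2::nat) ^ 3 \<le> 2 ^ w" by (intro power_increasing) auto
  then show "8 \<le> (2::nat) ^ w" by simp
  show "0 < w" using \<open>2 < w\<close> by simp
qed

end

section \<open>Deciding one step for one row\<close>

definition edge_out_prog :: com where
  "edge_out_prog =
     Cond (Reg 23)
       (seqs
         [Assign 33 (Add (Reg 5) (Mul (Num 4) (Sub (Reg 23) (Num 1)))),
          Assign 29 (Add (Inp (Reg 33)) (Num 1)),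
          Assign 30 (Inp (Add (Reg 33) (Num 2)))])
       (seqs [Assign 29 (Num 0), Assign 30 (Num 0)])"

text \<open>Register 22 holds the negated verdict: it starts at 1 and is cleared once all tests have
  succeeded. The first comparison decides ownership, since labels below \<open>h\<close> and rows
  below \<open>N\<close> are exactly those of the first side.\<close>

definition mark_prog :: com where
  "mark_prog = seqs
     [Assign 34 (Inp (Add (Num 5) (Reg 31))),
      Cond (Equal (Less (Reg 34) (Reg 2)) (Less (Reg 20) (Reg 0)))
        (seqs
          [Cond (Less (Reg 20) (Reg 0)) Skip (Assign 34 (Sub (Reg 34) (Reg 2))),
           Cond (Equal (Inp (Add (Reg 6) (Add (Mul (Reg 20) (Reg 2)) (Reg 34))))
               (Inp (Add (Reg 33) (Num 3))))
             (Assign 22 (Num 0)) Skip])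
        Skip]"

lemma wp_mark_prog:
  assumes s: "regs s 0 = N" "regs s 2 = h" "regs s 6 = a" "regs s 20 = z" "regs s 22 = 1"
      "regs s 31 = i" "regs s 33 = d"
    and w: "0 < w" "8 \<le> (2::nat) ^ w" "length inp < 2 ^ w" "\<And>k. k < length inp \<Longrightarrow> inp ! k < 2 ^ w"
    and l: "5 + i < length inp" "inp ! (5 + i) = l"
    and b: "d + 3 < length inp" "inp ! (d + 3) = of_bool b"
    and l': "l' = (if z < N then l else l - h)"
    and r: "l < h \<longleftrightarrow> z < N \<Longrightarrow> a + (z * h + l') < length inp \<and> inp ! (a + (z * h + l')) = of_bool r"
  shows "wp w inp mark_prog
    (\<lambda>k s'. k \<le> 60 \<and> regs s' 22 = of_bool (\<not> ((l < h \<longleftrightarrow> z < N) \<and> r = b))) s"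
proof -
  have lw: "(5 + i) mod 2 ^ w = 5 + i" "5 mod 2 ^ w = (5 :: nat)" "3 mod 2 ^ w = (3 :: nat)"
    "(d + 3) mod 2 ^ w = d + 3" "l mod 2 ^ w = l" "1 mod 2 ^ w = (1 :: nat)"
    using w l b by auto
  have o: "of_bool x mod 2 ^ w = (of_bool x :: nat)" for x using w by simp
  show ?thesis
  proof (cases "l < h \<longleftrightarrow> z < N")
    case True
    note r = r[OF True, THEN conjunct1] r[OF True, THEN conjunct2]
    have aw: "(a + (z * h + l')) mod 2 ^ w = a + (z * h + l')" "(z * h + l') mod 2 ^ w = z * h + l'"
      "(z * h) mod 2 ^ w = z * h"
      using r(1) w(3) by simp_all
    show ?thesis
    proof (cases "z < N")
      case zN: True
      then have "l < h" "l' = l" using True l' by auto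
      then show ?thesis
        unfolding mark_prog_def
        by (simp add: s lw l b aw[unfolded \<open>l' = l\<close>] r[unfolded \<open>l' = l\<close>] o zN w(1))
    next
      case zN: False
      then have "\<not> l < h" "l - h = l'" using True l' by auto
      then show ?thesis
        unfolding mark_prog_def
        by (simp add: s lw l b aw r o zN w(1))
    qed
  next
    case False
    then have "(l < h) = (\<not> z < N)" by blast
    then show ?thesis unfolding mark_prog_def by (simp add: s lw l o w(1))
  qed
qed

definition edge_in_prog :: com where
  "edge_in_prog =
     Cond (Equal (Reg 24) (Add (Reg 4) (Num 1)))
       (Cond (Equal (Reg 29) (Sub (Reg 3) (Num 1)))
         (Cond (Reg 30) Skip (Assign 22 (Num 0)))
         Skip)
       (seqs
         [Assign 33 (Add (Reg 5) (Mul (Num 4) (Sub (Reg 24) (Num 1)))),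
          Assign 31 (Inp (Reg 33)),
          Cond (Equal (Reg 29) (Reg 31))
            (Cond (Equal (Reg 30) (Inp (Add (Reg 33) (Num 1))))
              mark_prog
              Skip)
            Skip])"

text \<open>Guessed numbers need not denote vertices, so the range tests come before any access to
  the list of edges.\<close>

definition row_prog :: com where
  "row_prog = seqs
     [Assign 22 (Num 1),
      Cond (Equal (Reg 23) (Reg 24))
        (Assign 22 (Num 0))
        (Cond (Less (Reg 4) (Reg 23)) Skip
          (Cond (Less (Add (Reg 4) (Num 1)) (Reg 24)) Skip
            (Cond (Reg 24) (seqs [edge_out_prog, edge_in_prog]) Skip)))]"

lemma writes_row_prog [simp]:
  "writes edge_out_prog = {29, 30, 33}" "silent edge_out_prog"
  "writes mark_prog = {22, 34}" "silent mark_prog"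
  "writes edge_in_prog = {22, 31, 33, 34}" "silent edge_in_prog"
  "writes row_prog = {22, 29, 30, 31, 33, 34}" "silent row_prog"
  by (auto simp: edge_out_prog_def mark_prog_def edge_in_prog_def row_prog_def)

context bpsp_input
begin

lemma wp_edge_out_prog:
  assumes "regs s 5 = T + 4" "regs s 23 = p" "p \<le> E"
  shows "wp w inp edge_out_prog
    (\<lambda>k s'. k \<le> 30 \<and> regs s' 29 = fst (edge_out P p) \<and> regs s' 30 = snd (edge_out P p)) s"
proof (cases p)
  case 0
  then show ?thesis using assms w_gt by (simp add: edge_out_prog_def edge_out_def)
next
  case (Suc j)
  obtain i u v b where e: "bp_edges P ! j = (i, u, v, b)" by (metis prod_cases4)
  have j: "j < E" using Suc assms by simp
  have lt: "T + 4 + 4 * j + 3 < length inp" using j by (simp add: length_inp)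
  note E = inp_edge[OF j e] inp_mod[of "T + 4 + 4 * j"] inp_mod[of "T + 4 + 4 * j + 2"]
  have "i + 1 < 2 ^ w" using edge_wf(1)[OF j e] len_lt lt by linarith
  then show ?thesis using assms w_gt Suc lt len_lt E
    by (simp add: edge_out_prog_def edge_out_def e)
qed

lemma wp_edge_in_prog:
  assumes s: "regs s 0 = N" "regs s 2 = h" "regs s 3 = T" "regs s 4 = E" "regs s 5 = T + 4"
      "regs s 6 = T + 4 + 4 * E" "regs s 20 = z" "regs s 22 = 1" "regs s 24 = q"
      "regs s 29 = fst x" "regs s 30 = snd x"
    and z: "z < 2 * N" and q: "0 < q" "q \<le> E + 1"
  shows "wp w inp edge_in_prog
    (\<lambda>k s'. k \<le> 100 \<and> regs s' 22 = of_bool (\<not> (x = edge_in P q \<and> (q = E + 1 \<or>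
       (edge_label P q < h \<longleftrightarrow> z < N) \<and>
       rows ! z ! (if z < N then edge_label P q else edge_label P q - h) = edge_mark P q)))) s"
proof (cases "q = E + 1")
  case True
  have "E + 1 < 2 ^ w" using len_lt length_inp by linarith
  then show ?thesis using True s w_gt
    by (auto simp: edge_in_prog_def edge_in_def prod_eq_iff)
next
  case False
  define j where "j = q - 1"
  obtain i u v b where e: "bp_edges P ! j = (i, u, v, b)" by (metis prod_cases4)
  have j: "j < E" and qj: "q = Suc j" using False q by (auto simp: j_def)
  have lt: "T + 4 + 4 * j + 3 < length inp" using j by (simp add: length_inp)
  have i: "i + 1 < T" using edge_wf(1)[OF j e] .
  have E1: "E + 1 < 2 ^ w" "E + 1 \<noteq> q" using len_lt length_inp False by linarith+
  have l5: "5 + i < length inp" using i length_inp by linarith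
  have idx: "T + 4 + 4 * j < length inp" "T + 4 + 4 * j + 1 < length inp" using lt by linarith+
  have E: "inp ! (T + 4 + 4 * j) mod 2 ^ w = i" "inp ! (T + 4 + 4 * j + 1) mod 2 ^ w = u"
    using inp_mod[OF idx(1)] inp_mod[OF idx(2)] by (simp_all only: inp_edge[OF j e])
  define l where "l = bp_labels P ! i"
  define l' where "l' = (if z < N then l else l - h)"
  have el: "edge_label P q = l" "edge_mark P q = b" "edge_in P q = (i, u)"
    using E1(2) qj by (simp_all add: edge_label_def edge_mark_def edge_in_def e l_def)
  have l2: "l < 2 * h" using edge_wf(2)[OF j e] by (simp add: l_def)
  have row: "T + 4 + 4 * E + (z * h + l') < length inp \<and>
      inp ! (T + 4 + 4 * E + (z * h + l')) = of_bool (rows ! z ! l')" if "l < h \<longleftrightarrow> z < N"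
    using inp_row[OF z, of l'] that l2 by (auto simp: l'_def)
  have ent: "inp ! k < 2 ^ w" if "k < length inp" for k using that by (simp add: entries)
  have mark: "wp w inp mark_prog (\<lambda>k s''. k \<le> 60 \<and>
      regs s'' 22 = of_bool (\<not> ((l < h \<longleftrightarrow> z < N) \<and> rows ! z ! l' = b))) s'"
    if "regs s' 0 = N" "regs s' 2 = h" "regs s' 6 = T + 4 + 4 * E" "regs s' 20 = z" "regs s' 22 = 1"
      "regs s' 31 = i" "regs s' 33 = T + 4 + 4 * j" for s'
    by (rule wp_mark_prog[OF that w_gt(2,3) len_lt ent l5 inp_label[OF i, folded l_def]
          lt inp_edge(4)[OF j e] l'_def row])
  have "T + 4 + 4 * j + 3 < 2 ^ w" using lt len_lt by linarith
  note facts = this s w_gt(2,3) E1(1) idx E qj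
  have neq: "j \<noteq> E" using E1(2) qj by simp
  show ?thesis
  proof (cases "fst x = i \<and> snd x = u")
    case True
    then have "x = (i, u)" by (simp add: prod_eq_iff)
    define V :: nat where "V = of_bool (\<not> ((l < h \<longleftrightarrow> z < N) \<and> rows ! z ! l' = b))"
    have "wp w inp edge_in_prog (\<lambda>k s'. k \<le> 100 \<and> regs s' 22 = V) s"
      using True facts
      apply (simp add: edge_in_prog_def neq)
      apply (rule wp_mono[OF mark[folded V_def]])
             apply simp_all
      done
    then show ?thesis
      unfolding el l'_def[symmetric] V_def \<open>x = (i, u)\<close> using E1(2) by simp
  next
    case False
    then have "x \<noteq> (i, u)" by auto
    have "wp w inp edge_in_prog (\<lambda>k s'. k \<le> 100 \<and> regs s' 22 = 1) s"
    proof (cases "fst x = i")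
      case True
      then have "snd x \<noteq> u" using False by simp
      show ?thesis using facts True by (simp add: edge_in_prog_def neq \<open>snd x \<noteq> u\<close>)
    next
      case False
      show ?thesis using facts by (simp add: edge_in_prog_def neq False)
    qed
    with \<open>x \<noteq> (i, u)\<close> show ?thesis unfolding el by simp
  qed
qed

lemma wp_row_prog:
  assumes s: "regs s 0 = N" "regs s 2 = h" "regs s 3 = T" "regs s 4 = E" "regs s 5 = T + 4"
      "regs s 6 = T + 4 + 4 * E" "regs s 20 = z" "regs s 23 = p" "regs s 24 = q"
    and z: "z < 2 * N"
  shows "wp w inp row_prog
    (\<lambda>k s'. k \<le> 200 \<and> regs s' 22 = of_bool (\<not> row_ok P (z < N) (rows ! z) p q)) s"
proof (cases "p \<noteq> q \<and> p \<le> E \<and> 0 < q \<and> q \<le> E + 1")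
  case True
  have E1: "E + 1 < 2 ^ w" using len_lt length_inp by linarith
  have out: "wp w inp edge_out_prog R s'"
    if "regs s' 5 = T + 4" "regs s' 23 = p" and
      "\<And>k s''. k \<le> 30 \<Longrightarrow> regs s'' 29 = fst (edge_out P p) \<Longrightarrow> regs s'' 30 = snd (edge_out P p) \<Longrightarrow>
        \<forall>r. r \<notin> {29, 30, 33} \<longrightarrow> regs s'' r = regs s' r \<Longrightarrow> R k s''" for R s'
    using wp_frame[OF wp_edge_out_prog[of s' p], of R] that True by auto
  define V :: nat where "V = of_bool (\<not> row_ok P (z < N) (rows ! z) p q)"
  have V: "V = of_bool (\<not> (edge_out P p = edge_in P q \<and> (q = E + 1 \<or>
       (edge_label P q < h \<longleftrightarrow> z < N) \<and>
       rows ! z ! (if z < N then edge_label P q else edge_label P q - h) = edge_mark P q)))"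
    unfolding V_def row_ok_def edges_join_def h_def using True by auto
  have inn: "wp w inp edge_in_prog (\<lambda>k s''. k \<le> 100 \<and> regs s'' 22 = V) s'"
    if "regs s' 22 = 1" "regs s' 29 = fst (edge_out P p)" "regs s' 30 = snd (edge_out P p)"
      "\<forall>r. r \<notin> {22, 29, 30, 33} \<longrightarrow> regs s' r = regs s r" for s'
    unfolding V by (rule wp_edge_in_prog[OF _ _ _ _ _ _ _ _ _ _ _ z]) (use that s True in simp_all)
  have neq: "p \<noteq> q" and le: "p \<le> E" "0 < q" "q \<le> E + 1" using True by auto
  show ?thesis
    unfolding V_def[symmetric] row_prog_def using le s w_gt(2,3) E1
    apply (simp add: neq)
    apply (rule out)
      apply simp
     apply simp
    apply (rule wp_mono[OF inn])
        apply simp_all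
    done
next
  case False
  have E1: "E + 1 < 2 ^ w" using len_lt length_inp by linarith
  note facts = s w_gt(2,3) E1
  consider "p = q" | "p \<noteq> q" "E < p" | "p \<noteq> q" "p \<le> E" "E + 1 < q" | "p \<noteq> q" "p \<le> E" "q = 0"
    using False by linarith
  then show ?thesis
  proof cases
    case 1
    then show ?thesis using facts by (simp add: row_prog_def row_ok_def)
  next
    case 2
    then have "\<not> edges_join P p q" by (simp add: edges_join_def)
    then show ?thesis using facts 2(2) by (simp add: row_prog_def row_ok_def 2(1))
  next
    case 3
    then have "\<not> edges_join P p q" by (simp add: edges_join_def)
    then show ?thesis using facts 3(2,3) by (simp add: row_prog_def row_ok_def 3(1))
  next
    case 4
    then have "\<not> edges_join P p q" by (simp add: edges_join_def)
    moreover have "0 < p" using 4 by simp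
    ultimately show ?thesis using facts 4(2,3) by (simp add: row_prog_def row_ok_def)
  qed
qed

end

section \<open>Loops for positions, row numbers and logarithms\<close>

definition round_prog :: com where
  "round_prog = seqs
     [Assign 27 (Div (Reg 27) (Num 4)),
      Assign 28 (Mod (Div (Reg 21) (Reg 27)) (Num 4)),
      Assign 25 (Add (Mul (Num 2) (Reg 25)) (Div (Reg 28) (Num 2))),
      Assign 26 (Add (Reg 26) (Num 1)),
      Cond (Equal (Reg 26) (Reg 7))
        (seqs
          [Cond (Mod (Reg 28) (Num 2)) (Assign 23 (Reg 25)) (Assign 24 (Reg 25)),
           Assign 25 (Num 0), Assign 26 (Num 0)])
        Skip]"

definition rounds_loop :: com where
  "rounds_loop = While (Less (Num 1) (Reg 27)) round_prog"

text \<open>Register 27 holds a power of 4 that both selects the next digit and counts the rounds.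
  Because of \<open>g < 2 ^ c\<close> and \<open>c < m\<close>, doubling the guess and adding a bit
  never overflows.\<close>

lemma wp_rounds_loop:
  assumes "regs s 7 = m" "regs s 21 = x" "regs s 27 = 4 ^ r"
    "(regs s 23, regs s 24, regs s 25, regs s 26) = (p, q, g, c)" "c < m" "g < 2 ^ c"
    and w: "0 < w" "8 \<le> (2::nat) ^ w" "2 ^ m \<le> (2::nat) ^ w" "m < 2 ^ w"
  shows "wp w inp rounds_loop (\<lambda>k s'. k \<le> 60 * r + 5 \<and>
    (regs s' 23, regs s' 24, regs s' 25, regs s' 26) = rounds m r x (p, q, g, c)) s"
  using assms(1-6)
proof (induction r arbitrary: s p q g c)
  case 0
  then show ?case unfolding rounds_loop_def using w by (intro wp_While_False) auto
next
  case (Suc r)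
  define d where "d = x div 4 ^ r mod 4"
  define g' where "g' = 2 * g + d div 2"
  have "d < 4" by (simp add: d_def)
  then have "g' < 2 * (g + 1)" unfolding g'_def by simp
  also have "\<dots> \<le> 2 ^ Suc c" using Suc.prems(6) by simp
  finally have g': "g' < 2 ^ Suc c" .
  have "(2::nat) ^ Suc c \<le> 2 ^ m" using Suc.prems(5) by (intro power_increasing) auto
  with g' w(3) have gw: "g' < 2 ^ w" by linarith
  have g2: "2 * g < 2 ^ w" using gw by (simp add: g'_def)
  have dw: "d mod 2 = of_bool (odd d)" by (simp add: mod_2_eq_odd)
  let ?\<sigma> = "round_step m (p, q, g, c) d"
  obtain p1 q1 g1 c1 where \<sigma>: "?\<sigma> = (p1, q1, g1, c1)" by (metis prod_cases4)
  have c1: "c1 < m" "g1 < 2 ^ c1"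
    using \<sigma> Suc.prems(5) g' by (auto simp: g'_def split: if_splits)
  have IH: "wp w inp rounds_loop (\<lambda>k s'. k \<le> 60 * r + 5 \<and>
    (regs s' 23, regs s' 24, regs s' 25, regs s' 26) = rounds m r x (p1, q1, g1, c1)) s'"
    if "regs s' 7 = m" "regs s' 21 = x" "regs s' 27 = 4 ^ r"
      "(regs s' 23, regs s' 24, regs s' 25, regs s' 26) = (p1, q1, g1, c1)" for s'
    using Suc.IH[OF that c1] .
  have rn: "rounds m (Suc r) x (p, q, g, c) = rounds m r x (p1, q1, g1, c1)"
    by (simp only: rounds.simps d_def[symmetric] \<sigma>)
  have s: "regs s 7 = m" "regs s 21 = x" "regs s 27 = 4 ^ Suc r" "regs s 23 = p" "regs s 24 = q"
    "regs s 25 = g" "regs s 26 = c" using Suc.prems by auto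
  have md: "2 * g mod 2 ^ w = 2 * g" "(2 * g + d div 2) mod 2 ^ w = g'" "4 mod 2 ^ w = (4::nat)"
    "2 mod 2 ^ w = (2::nat)" "Suc c mod 2 ^ w = Suc c" "m mod 2 ^ w = m" "(4 * 4 ^ r) div 4 = (4 ^ r :: nat)"
    using gw g2 w Suc.prems(5) by (auto simp: g'_def[symmetric])
  have big: "1 < (4::nat) ^ Suc r" by (rule one_less_power) auto
  have body: "wp w inp round_prog (\<lambda>k1. wp w inp rounds_loop
      (\<lambda>k2 s'. rcost (Less (Num 1) (Reg 27)) + 1 + k1 + k2 \<le> 60 * Suc r + 5 \<and>
        (regs s' 23, regs s' 24, regs s' 25, regs s' 26) = rounds m r x (p1, q1, g1, c1))) s"
  proof (cases "Suc c = m")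
    case True
    then have \<sigma>': "(p1, q1, g1, c1) = (if odd d then (g', q, 0, 0) else (p, g', 0, 0))"
      using \<sigma> by (auto simp: g'_def split: if_splits)
    show ?thesis
    proof (cases "odd d")
      case o: True
      show ?thesis
        using \<sigma>'
        apply (simp add: round_prog_def s md w(1) d_def[symmetric] True dw o)
        apply (rule wp_mono[OF IH])
            apply (simp_all add: s)
        done
    next
      case o: False
      show ?thesis
        using \<sigma>'
        apply (simp add: round_prog_def s md w(1) d_def[symmetric] True dw o)
        apply (rule wp_mono[OF IH])
            apply (simp_all add: s)
        done
    qed
  next
    case False
    then have "(p1, q1, g1, c1) = (p, q, g', Suc c)"
      using \<sigma> by (simp add: g'_def)
    then show ?thesis
      apply (simp add: round_prog_def s md w(1) d_def[symmetric] False)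
      apply (rule wp_mono[OF IH])
          apply (simp_all add: s)
      done
  qed
  show ?case
    unfolding rn rounds_loop_def
  proof (rule wp_While_True)
    show "rval w inp s (Less (Num 1) (Reg 27)) \<noteq> 0" using w(1) big by (simp add: s)
  qed (use body in \<open>simp only: rounds_loop_def\<close>)
qed

text \<open>The quotient by a power of 2 is obtained by repeated halving, because the shift distance
  can be close to \<open>4 ^ (m * m)\<close> and the power itself need not fit into a word.\<close>

definition shift_loop :: com where
  "shift_loop = While (Reg 28)
     (Seq (Assign 22 (Div (Reg 22) (Num 2))) (Assign 28 (Sub (Reg 28) (Num 1))))"

lemma wp_shift_loop:
  assumes "regs s 22 = z" "regs s 28 = n" "0 < w" "8 \<le> (2::nat) ^ w"
  shows "wp w inp shift_loop (\<lambda>k s'. k \<le> n * 10 + 2 \<and> regs s' 22 = z div 2 ^ n) s"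
proof -
  let ?I = "\<lambda>j (s'::ram_state). regs s' 28 = n - j \<and> regs s' 22 = z div 2 ^ j"
  have "wp w inp (While (Reg 28) (Seq (Assign 22 (Div (Reg 22) (Num 2))) (Assign 28 (Sub (Reg 28) (Num 1)))))
    (\<lambda>k s'. k \<le> n * (rcost (Reg 28) + 1 + 8) + rcost (Reg 28) + 1 \<and> ?I n s') s"
    by (rule wp_while[where I = ?I])
      (use assms in \<open>auto simp: div_mult2_eq[symmetric] mult.commute\<close>)
  then show ?thesis unfolding shift_loop_def by (rule wp_mono) auto
qed

definition floorlog_loop :: com where
  "floorlog_loop = While (Reg 13)
     (Seq (Assign 13 (Div (Reg 13) (Num 2))) (Assign 12 (Add (Reg 12) (Num 1))))"

lemma wp_floorlog_loop:
  assumes "regs s 13 = x" "regs s 12 = t" "t + floorlog 2 x < 2 ^ w" "0 < w" "8 \<le> (2::nat) ^ w"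
  shows "wp w inp floorlog_loop
    (\<lambda>k s'. k \<le> 10 * floorlog 2 x + 2 \<and> regs s' 12 = t + floorlog 2 x) s"
  using assms
proof (induction x arbitrary: s t rule: less_induct)
  case (less x)
  show ?case
  proof (cases "x = 0")
    case True
    then show ?thesis unfolding floorlog_loop_def using less.prems
      by (intro wp_While_False) (auto simp: floorlog_def)
  next
    case False
    have fl: "floorlog 2 x = floorlog 2 (x div 2) + 1"
      using False compute_floorlog[of 2 x] by simp
    let ?s = "s\<lparr>regs := (regs s)(13 := x div 2, 12 := Suc t)\<rparr>"
    have "wp w inp floorlog_loop (\<lambda>k s'. k \<le> 10 * floorlog 2 (x div 2) + 2 \<and>
        regs s' 12 = Suc t + floorlog 2 (x div 2)) ?s"
      using False less.prems(3-5) fl by (intro less.IH) auto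
    then show ?thesis
      unfolding floorlog_loop_def using less.prems False fl
      by (intro wp_While_True) (auto elim!: wp_mono)
  qed
qed

definition log_loop :: com where
  "log_loop = While (Less (Reg 14) (Reg 12))
     (Seq (Assign 14 (Mul (Num 2) (Reg 14))) (Assign 7 (Add (Reg 7) (Num 1))))"

lemma wp_log_loop:
  assumes "regs s 14 = 1" "regs s 7 = 0" "regs s 12 = t" "t \<le> 2 ^ m" "\<And>j. j < m \<Longrightarrow> 2 ^ j < t"
    "2 ^ m < (2::nat) ^ w" "0 < w" "8 \<le> (2::nat) ^ w"
  shows "wp w inp log_loop (\<lambda>k s'. k \<le> m * 15 + 5 \<and> regs s' 7 = m) s"
proof -
  let ?I = "\<lambda>j (s'::ram_state). regs s' 14 = 2 ^ j \<and> regs s' 7 = j \<and> regs s' 12 = t"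
  have "wp w inp (While (Less (Reg 14) (Reg 12))
     (Seq (Assign 14 (Mul (Num 2) (Reg 14))) (Assign 7 (Add (Reg 7) (Num 1)))))
    (\<lambda>k s'. k \<le> m * (rcost (Less (Reg 14) (Reg 12)) + 1 + 11) + rcost (Less (Reg 14) (Reg 12)) + 1 \<and> ?I m s') s"
  proof (rule wp_while[where I = ?I])
    fix j and s' :: ram_state assume j: "j < m" and I: "?I j s'"
    have "(2::nat) ^ Suc j \<le> 2 ^ m" using j by (intro power_increasing) auto
    then have a: "2 * 2 ^ j < (2::nat) ^ w" using assms(6) by (metis le_less_trans power_Suc)
    have "j < 2 ^ j" by (rule less_exp)
    then have b: "Suc j < 2 ^ w" using a by linarith
    show "rval w inp s' (Less (Reg 14) (Reg 12)) \<noteq> 0 \<and>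
      wp w inp (Seq (Assign 14 (Mul (Num 2) (Reg 14))) (Assign 7 (Add (Reg 7) (Num 1))))
        (\<lambda>k s'. k \<le> 11 \<and> ?I (Suc j) s') s'"
      using a b I assms(5)[OF j] assms(7,8) by simp
  qed (use assms in auto)
  then show ?thesis unfolding log_loop_def by (rule wp_mono) auto
qed

lemma writes_loops [simp]:
  "writes rounds_loop = {23, 24, 25, 26, 27, 28}" "silent rounds_loop"
  "writes shift_loop = {22, 28}" "silent shift_loop"
  "writes floorlog_loop = {12, 13}" "silent floorlog_loop"
  "writes log_loop = {7, 14}" "silent log_loop"
  by (auto simp: rounds_loop_def round_prog_def shift_loop_def floorlog_loop_def log_loop_def)


section \<open>Computing one tensor entry\<close>

definition entry_prog :: com where
  "entry_prog = seqs
     [Assign 20 (Div (Reg 10) (Reg 11)), Assign 21 (Mod (Reg 10) (Reg 11)),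
      Assign 28 (Div (Reg 21) (Reg 8)),
      Cond (Equal (Reg 28) (Num 2))
        (Assign 22 (Num 1))
        (Cond (Equal (Reg 28) (Num 3))
          (seqs
            [Assign 22 (Reg 20), Assign 28 (Mod (Reg 21) (Reg 8)), shift_loop,
             Assign 22 (Mod (Reg 22) (Num 2))])
          (seqs
            [Assign 23 (Num 0), Assign 24 (Add (Reg 4) (Num 1)), Assign 25 (Num 0),
             Assign 26 (Num 0), Assign 27 (Reg 8), rounds_loop, row_prog])),
      Emit (Reg 22)]"

lemma writes_entry_prog [simp]:
  "writes entry_prog = {20, 21, 22, 23, 24, 25, 26, 27, 28, 29, 30, 31, 33, 34}"
  by (auto simp: entry_prog_def)

context bpsp_input
begin

definition entry :: "nat \<Rightarrow> nat \<Rightarrow> nat \<Rightarrow> bool" where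
  "entry m z pos = savitch_entry P m (z < N) (rows ! z) z pos"

text \<open>The term \<open>10 * 4 ^ (m * m)\<close> pays for shifting the row number, the term
  \<open>60 * (m * m)\<close> for the rounds of the game.\<close>

lemma wp_entry_prog:
  assumes s: "regs s 0 = N" "regs s 2 = h" "regs s 3 = T" "regs s 4 = E" "regs s 5 = T + 4"
      "regs s 6 = T + 4 + 4 * E" "regs s 7 = m" "regs s 8 = 4 ^ (m * m)" "regs s 10 = r"
      "regs s 11 = 4 * 4 ^ (m * m)"
    and r: "r < 2 * N * (4 * 4 ^ (m * m))"
    and m: "0 < m" "2 ^ m \<le> (2::nat) ^ w"
  shows "wp w inp entry_prog (\<lambda>k s'. k \<le> 60 * (m * m) + 10 * 4 ^ (m * m) + 400 \<and>
    outp s' = outp s @ [of_bool (entry m (r div (4 * 4 ^ (m * m))) (r mod (4 * 4 ^ (m * m))))]) s"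
proof -
  define M :: nat where "M = 4 ^ (m * m)"
  define z where "z = r div (4 * M)"
  define x where "x = r mod (4 * M)"
  define d where "d = x div M"
  define y where "y = x mod M"
  have M: "0 < M" by (simp add: M_def)
  have z: "z < 2 * N" using r unfolding z_def M_def by (metis less_mult_imp_div_less)
  have y: "y < M" using M by (simp add: y_def)
  have E1: "E + 1 < 2 ^ w" using len_lt length_inp by linarith
  have mw: "m < 2 ^ w" using m(2) less_exp[of m] by linarith
  have s8: "regs s 8 = M" "regs s 11 = 4 * M" using s by (simp_all add: M_def)
  have md: "2 mod 2 ^ w = (2::nat)" "3 mod 2 ^ w = (3::nat)" "Suc E mod 2 ^ w = Suc E"
    using w_gt(3) E1 by simp_all
  note sx = s(1-7,9) s8
  note df = z_def[symmetric] x_def[symmetric] d_def[symmetric] y_def[symmetric]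
  define V :: nat where "V = of_bool (entry m z x)"
  have "wp w inp entry_prog (\<lambda>k s'. k \<le> 60 * (m * m) + 10 * M + 400 \<and> outp s' = outp s @ [V]) s"
  proof -
    consider "d = 2" | "d = 3" | "d \<noteq> 2" "d \<noteq> 3" by blast
    then show ?thesis
    proof cases
      case 1
      then have "V = 1" by (simp add: V_def entry_def savitch_entry_def d_def M_def)
      then show ?thesis by (simp add: entry_prog_def sx df 1 md w_gt(2))
    next
      case 2
      then have V: "V = z div 2 ^ y mod 2"
        by (simp add: V_def entry_def savitch_entry_def d_def M_def y_def mod_2_eq_odd)
      show ?thesis
        apply (simp add: entry_prog_def sx df 2 md w_gt(2))
        apply (rule wp_frame[OF wp_shift_loop[where z = z and n = y]])
            apply (simp_all add: w_gt(2,3))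
        using y apply (simp add: V)
        done
    next
      case 3
      obtain p q g c where rd: "rounds m (m * m) x (0, E + 1, 0, 0) = (p, q, g, c)"
        by (metis prod_cases4)
      then have V: "V = of_bool (\<not> row_ok P (z < N) (rows ! z) p q)"
        using 3 by (simp add: V_def entry_def savitch_entry_def d_def M_def)
      show ?thesis
        apply (simp add: entry_prog_def sx df 3 md w_gt(2))
        apply (rule wp_frame[OF wp_rounds_loop[where m = m and x = x and r = "m * m"
                and p = 0 and q = "E + 1" and g = 0 and c = 0]])
                  apply (simp_all add: m w_gt(2,3) mw M_def sx del: rounds.simps)
        unfolding rd[simplified]
        apply (rule wp_frame[OF wp_row_prog[where z = z and p = p and q = q, folded V]])
                 apply (simp_all add: z sx)
        done
    qed
  qed
  then show ?thesis by (simp only: V_def M_def z_def x_def)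
qed

end

text \<open>This turns the nested enumeration of rows and positions into a single loop whose counter
  is split by \<open>div\<close> and \<open>mod\<close>.\<close>

lemma concat_map_upt:
  assumes "0 < S"
  shows "concat (map (\<lambda>z. map (f z) [0..<S]) [0..<n]) = map (\<lambda>r. f (r div S) (r mod S)) [0..<n * S]"
proof (induction n)
  case (Suc n)
  have "map (\<lambda>r. f (r div S) (r mod S)) [n * S..<n * S + S] = map (f n) [0..<S]"
    using assms by (intro nth_equalityI) auto
  moreover have "[0..<Suc n * S] = [0..<n * S] @ [n * S..<n * S + S]"
    by (metis add.commute mult_Suc upt_add_eq_append zero_le)
  ultimately show ?case using Suc by simp
qed simp

section \<open>The complete reduction to tensors\<close>

definition bpsp_to_oapt_prog :: com where
  "bpsp_to_oapt_prog = seqs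
     [Assign 0 (Inp (Num 0)), Assign 2 (Div (Inp (Num 1)) (Num 2)), Assign 3 (Inp (Num 2)),
      Assign 4 (Inp (Num 4)), Assign 5 (Add (Reg 3) (Num 4)),
      Assign 6 (Add (Reg 5) (Mul (Num 4) (Reg 4))),
      Assign 12 (Add (Reg 4) (Num 3)), Assign 13 (Reg 0), floorlog_loop,
      Assign 7 (Num 0), Assign 14 (Num 1), log_loop,
      Assign 13 (Mul (Reg 7) (Reg 7)), Assign 8 (Num 1), pow_loop 13 8 4,
      Assign 11 (Mul (Num 4) (Reg 8)), Assign 9 (Mul (Mul (Num 2) (Reg 0)) (Reg 11)),
      Emit (Reg 0), Emit (Mul (Num 2) (Add (Mul (Reg 7) (Reg 7)) (Num 1))),
      for_loop 10 9 entry_prog]"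

text \<open>Two demands are met by one sum: at least \<open>bp_size P + 2\<close> vertices must be
  numbered by \<open>m\<close> bits, and the \<open>Suc (floorlog 2 N)\<close> bits of the numbers
  of all \<open>2 * N\<close> rows must fit into a block.\<close>

definition savitch_depth :: "bpsp \<Rightarrow> nat" where
  "savitch_depth I = (LEAST m. bp_size (bpsp_bp I) + 3 + floorlog 2 (length (bpsp_A I)) \<le> 2 ^ m)"

lemma savitch_depth:
  "bp_size (bpsp_bp I) + 3 + floorlog 2 (length (bpsp_A I)) \<le> 2 ^ savitch_depth I"
  "j < savitch_depth I \<Longrightarrow> 2 ^ j < bp_size (bpsp_bp I) + 3 + floorlog 2 (length (bpsp_A I))"
proof -
  have "\<exists>m. bp_size (bpsp_bp I) + 3 + floorlog 2 (length (bpsp_A I)) \<le> 2 ^ m"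
    by (meson less_exp less_imp_le)
  then show "bp_size (bpsp_bp I) + 3 + floorlog 2 (length (bpsp_A I)) \<le> 2 ^ savitch_depth I"
    unfolding savitch_depth_def by (rule LeastI_ex)
  show "2 ^ j < bp_size (bpsp_bp I) + 3 + floorlog 2 (length (bpsp_A I))" if "j < savitch_depth I"
    using not_less_Least[OF that[unfolded savitch_depth_def]] by simp
qed

definition bpsp_to_oapt :: "bpsp \<Rightarrow> oapt" where
  "bpsp_to_oapt I =
     (let m = savitch_depth I; N = length (bpsp_A I);
          tensor = (\<lambda>z. savitch_tensor (bpsp_bp I) m (z < N) ((bpsp_A I @ bpsp_B I) ! z) z)
      in \<lparr>oapt_t = 2 * (m * m + 1), oapt_A = map tensor [0..<N], oapt_B = map tensor [N..<2 * N]\<rparr>)"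

lemma bpsp_to_oapt_correct:
  assumes I: "bpsp_inst I"
  shows "oapt_inst (bpsp_to_oapt I)" "oapt_yes (bpsp_to_oapt I) = bpsp_yes I"
proof -
  define m where "m = savitch_depth I"
  define N where "N = length (bpsp_A I)"
  define tensor where "tensor z = savitch_tensor (bpsp_bp I) m (z < N) ((bpsp_A I @ bpsp_B I) ! z) z" for z
  have red: "bpsp_to_oapt I =
      \<lparr>oapt_t = 2 * (m * m + 1), oapt_A = map tensor [0..<N], oapt_B = map tensor [N..<2 * N]\<rparr>"
    by (simp add: bpsp_to_oapt_def Let_def m_def N_def tensor_def)
  have m: "bp_size (bpsp_bp I) + 3 + floorlog 2 N \<le> 2 ^ m"
    unfolding m_def N_def by (rule savitch_depth)
  have B: "length (bpsp_B I) = N" using I by (simp add: bpsp_inst_def N_def)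
  have "2 * N \<le> 2 ^ (4 ^ (m * m))"
  proof -
    have "N < 2 ^ floorlog 2 N"
      using floorlog_bounds[of N 2] by (cases "N = 0") auto
    then have "2 * N \<le> 2 ^ Suc (floorlog 2 N)" by simp
    also have "\<dots> \<le> 2 ^ (4 ^ (m * m))"
    proof (rule power_increasing)
      have "Suc (floorlog 2 N) \<le> 2 ^ m" using m by simp
      also have "\<dots> \<le> 4 ^ m" by (intro power_mono) auto
      also have "\<dots> \<le> 4 ^ (m * m)" by (intro power_increasing) (cases m, auto)
      finally show "Suc (floorlog 2 N) \<le> 4 ^ (m * m)" .
    qed simp
    finally show ?thesis .
  qed
  then have "inj_on tensor {..<2 * N}"
    by (intro inj_onI) (auto simp: tensor_def intro: savitch_tensor_inj)
  then have "distinct (map tensor [0..<N])" "distinct (map tensor [N..<2 * N])"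
    by (auto simp: distinct_map intro: inj_on_subset)
  moreover have "length (tensor z) = 2 ^ (2 * (m * m + 1))" for z
    by (simp add: tensor_def savitch_tensor_def power_mult power_add)
  ultimately show "oapt_inst (bpsp_to_oapt I)" unfolding red oapt_inst_def by auto
  have p: "p_alt (2 * (m * m + 1)) (tensor i) (tensor (N + j)) \<longleftrightarrow>
      \<not> bp_accepts (bpsp_bp I) (bpsp_A I ! i @ bpsp_B I ! j)" if "i < N" "j < N" for i j
  proof -
    have "length (bpsp_A I ! i) = bp_inputs (bpsp_bp I) div 2"
      using I that by (auto simp: bpsp_inst_def N_def)
    moreover have "tensor i = savitch_tensor (bpsp_bp I) m True (bpsp_A I ! i) i"
      "tensor (N + j) = savitch_tensor (bpsp_bp I) m False (bpsp_B I ! j) (N + j)"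
      using that by (simp_all add: tensor_def nth_append N_def)
    ultimately show ?thesis
      using savitch_tensor_correct[of "bpsp_bp I" m "bpsp_A I ! i" i "bpsp_B I ! j" "N + j"] I m
      by (simp add: bpsp_inst_def)
  qed
  have "oapt_yes (bpsp_to_oapt I) \<longleftrightarrow>
      (\<exists>i<N. \<exists>j<N. \<not> p_alt (2 * (m * m + 1)) (tensor i) (tensor (N + j)))"
  proof -
    have "set (map tensor [N..<2 * N]) = (\<lambda>j. tensor (N + j)) ` {..<N}"
    proof -
      have "{N..<2 * N} = (\<lambda>j. N + j) ` {..<N}"
        using image_add_atLeastLessThan[of N 0 N] by (simp add: mult_2 atLeast0LessThan)
      then show ?thesis by (metis image_image list.set_map set_upt)
    qed
    then show ?thesis unfolding red oapt_yes_def oapt.simps by (auto simp del: upt_Suc)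
  qed
  also have "\<dots> \<longleftrightarrow> (\<exists>i<N. \<exists>j<N. bp_accepts (bpsp_bp I) (bpsp_A I ! i @ bpsp_B I ! j))"
    using p by auto
  also have "\<dots> \<longleftrightarrow> bpsp_yes I"
    unfolding bpsp_yes_def by (metis B N_def in_set_conv_nth)
  finally show "oapt_yes (bpsp_to_oapt I) = bpsp_yes I" .
qed

context bpsp_input
begin

lemma enc_bpsp_to_oapt:
  assumes "m = savitch_depth I" "S = 4 * 4 ^ (m * m)"
  shows "enc_oapt (bpsp_to_oapt I) =
    [N, 2 * (m * m + 1)] @ concat (map (\<lambda>r. [of_bool (entry m (r div S) (r mod S))]) [0..<2 * N * S])"
proof -
  have S: "0 < S" using assms by simp
  let ?t = "\<lambda>z. map (entry m z) [0..<S]"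
  have "[0..<N] @ [N..<2 * N] = [0..<2 * N]"
    using upt_add_eq_append[of 0 N N] by (simp add: mult_2)
  then have "concat (map ?t [0..<N]) @ concat (map ?t [N..<2 * N]) = concat (map ?t [0..<2 * N])"
    by (metis concat_append map_append)
  also have "\<dots> = map (\<lambda>r. entry m (r div S) (r mod S)) [0..<2 * N * S]"
    using concat_map_upt[OF S, of "entry m" "2 * N"] by simp
  finally have "map of_bool (concat (map ?t [0..<N])) @ map of_bool (concat (map ?t [N..<2 * N])) =
      map (\<lambda>r. of_bool (entry m (r div S) (r mod S)) :: nat) [0..<2 * N * S]"
    by (simp flip: map_append)
  moreover have "savitch_tensor P m (z < N) (rows ! z) z = ?t z" for z
    unfolding savitch_tensor_def assms(2) by (simp add: entry_def)
  ultimately show ?thesis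
    unfolding enc_oapt_def bpsp_to_oapt_def Let_def assms(1)[symmetric]
    by (simp add: enc_bits_def)
qed

text \<open>Each of the \<open>2 * N * S\<close> entries costs at most a constant times
  \<open>S\<close>, which gives the square; finding the depth and the powers is cheaper than a
  constant times \<open>S\<close>.\<close>

lemma wp_bpsp_to_oapt_prog:
  assumes m: "m = savitch_depth I" and S: "S = 4 * 4 ^ (m * m)" and w: "2 * (N + 1) * S < 2 ^ w"
  shows "wp w inp bpsp_to_oapt_prog
    (\<lambda>k s'. k \<le> 1000 * (N + 1) * S\<^sup>2 \<and> outp s' = enc_oapt (bpsp_to_oapt I)) init_state"
proof -
  define M :: nat where "M = 4 ^ (m * m)"
  define t where "t = E + 3 + floorlog 2 N"
  have t: "t \<le> 2 ^ m" "\<And>j. j < m \<Longrightarrow> 2 ^ j < t"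
    unfolding t_def m by (auto intro: savitch_depth)
  have m0: "0 < m" using t(1) by (cases m) (auto simp: t_def)
  have SM: "S = 4 * M" using S by (simp add: M_def)
  have "m * m < 2 ^ (m * m)" by (rule less_exp)
  also have "\<dots> \<le> M" unfolding M_def by (intro power_mono) auto
  finally have mM: "m * m < M" .
  have "(2::nat) ^ m \<le> 4 ^ m" by (intro power_mono) auto
  also have "\<dots> \<le> M" unfolding M_def using m0 by (intro power_increasing) auto
  finally have tM: "2 ^ m \<le> M" .
  have w': "8 * M < 2 ^ w" "2 * N * (4 * M) < 2 ^ w" "2 * N < 2 ^ w"
  proof -
    have "8 * M + 2 * N * (4 * M) < 2 ^ w" using w unfolding SM by (simp add: algebra_simps)
    then show a: "8 * M < 2 ^ w" "2 * N * (4 * M) < 2 ^ w" by linarith+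
    have "2 * N * 1 \<le> 2 * N * (4 * M)" using mM by (intro mult_le_mono) auto
    then show "2 * N < 2 ^ w" using a(2) by linarith
  qed
  have sm1: "2 ^ m < (2::nat) ^ w" using w'(1) tM by linarith
  have sm: "t < 2 ^ w" "m * m < 2 ^ w" "4 * M < 2 ^ w" "M < 2 ^ w"
    "2 * (m * m + 1) < 2 ^ w" "m * m + 1 < 2 ^ w"
    using w'(1) tM t(1) mM Suc_leI[OF mM] by simp_all
  have l: "T + 4 + 4 * E < 2 ^ w" using len_lt length_inp by linarith
  have el: "wp w inp (for_loop 10 9 entry_prog)
      (\<lambda>k s'. k \<le> 2 * N * S * (60 * (m * m) + 10 * M + 400 + 8) + 6 \<and>
        outp s' = outp s @ concat (map (\<lambda>r. [of_bool (entry m (r div S) (r mod S))]) [0..<2 * N * S]) \<and>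
        (\<forall>r. r \<notin> insert 10 (writes entry_prog) \<longrightarrow> regs s' r = regs s r)) s"
    if "regs s 0 = N" "regs s 2 = h" "regs s 3 = T" "regs s 4 = E" "regs s 5 = T + 4"
      "regs s 6 = T + 4 + 4 * E" "regs s 7 = m" "regs s 8 = M" "regs s 9 = 2 * N * S" "regs s 11 = S" for s
  proof (rule wp_for_loop)
    fix r and s' :: ram_state
    assume "r < 2 * N * S" "regs s' 10 = r" "\<forall>r. r \<notin> insert 10 (writes entry_prog) \<longrightarrow> regs s' r = regs s r"
    then show "wp w inp entry_prog (\<lambda>k s''. k \<le> 60 * (m * m) + 10 * M + 400 \<and>
        outp s'' = outp s' @ [of_bool (entry m (r div S) (r mod S))]) s'"
      unfolding S M_def using that sm1 m0 by (intro wp_entry_prog) (simp_all add: S M_def)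
  qed (use that w'(2) w_gt SM in auto)
  have cost: "k1 + (k2 + (k3 + k4)) + 200 \<le> 1000 * (N + 1) * S\<^sup>2"
    if "k1 \<le> 10 * floorlog 2 N + 2" "k2 \<le> m * 15 + 5" "k3 \<le> m * m * 10 + 2"
      "k4 \<le> 2 * N * S * (60 * (m * m) + 10 * M + 400 + 8) + 6" for k1 k2 k3 k4
  proof -
    have M1: "1 \<le> M" using mM by simp
    have "60 * (m * m) + 10 * M + 400 + 8 \<le> 478 * M" using mM M1 by linarith
    then have "2 * N * S * (60 * (m * m) + 10 * M + 400 + 8) \<le> 2 * N * S * (478 * M)"
      by (intro mult_le_mono2)
    moreover have "2 * N * S * (478 * M) = 3824 * (N * (M * M))" by (simp add: SM)
    ultimately have a: "k4 \<le> 3824 * (N * (M * M)) + 6" using that(4) by linarith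
    have "m \<le> m * m" using m0 by simp
    then have b: "k1 + (k2 + k3) + 206 \<le> 300 * M"
      using that(1-3) tM t(1) mM M1 unfolding t_def by linarith
    have "M \<le> M * M" using M1 by simp
    then have "k1 + (k2 + (k3 + k4)) + 200 \<le> 16000 * (M * M) + 16000 * (N * (M * M))"
      using a b by linarith
    then show ?thesis by (simp add: SM power2_eq_square algebra_simps)
  qed
  have inp_i: "inp ! 0 mod 2 ^ w = N" "inp ! Suc 0 mod 2 ^ w = bp_inputs P" "inp ! 2 mod 2 ^ w = T" "inp ! 4 mod 2 ^ w = E"
    "inp \<noteq> []" "Suc 0 < length inp" "2 < length inp" "4 < length inp"
  proof -
    show lt: "Suc 0 < length inp" "2 < length inp" "4 < length inp" and ne: "inp \<noteq> []"
      using w_gt(1) by auto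
    show "inp ! 0 mod 2 ^ w = N" "inp ! Suc 0 mod 2 ^ w = bp_inputs P" "inp ! 2 mod 2 ^ w = T"
      "inp ! 4 mod 2 ^ w = E"
      using inp_mod[of 0] inp_mod[OF lt(1)] inp_mod[OF lt(2)] inp_mod[OF lt(3)] ne inp_header by auto
  qed
  have w4: "4 < (2::nat) ^ w" using w_gt(3) by linarith
  have md: "4 mod 2 ^ w = (4::nat)" "3 mod 2 ^ w = (3::nat)" "2 mod 2 ^ w = (2::nat)"
    "(T + 4) mod 2 ^ w = T + 4" "4 * E mod 2 ^ w = 4 * E" "(T + 4 + 4 * E) mod 2 ^ w = T + 4 + 4 * E"
    "(E + 3) mod 2 ^ w = E + 3" "m * m mod 2 ^ w = m * m" "4 * M mod 2 ^ w = 4 * M"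
    "2 * N mod 2 ^ w = 2 * N" "2 * N * (4 * M) mod 2 ^ w = 2 * N * (4 * M)"
    "8 * (N * M) mod 2 ^ w = 8 * (N * M)" "Suc (Suc (2 * (m * m))) mod 2 ^ w = Suc (Suc (2 * (m * m)))"
    "Suc (m * m) mod 2 ^ w = Suc (m * m)" "(2 * Suc (m * m)) mod 2 ^ w = 2 * Suc (m * m)"
    using w_gt(3) l w' sm by simp_all
  show ?thesis
    unfolding bpsp_to_oapt_prog_def enc_bpsp_to_oapt[OF m S]
    apply (simp add: init_state_def inp_i md w_gt(2) h_def[symmetric])
    apply (rule wp_frame[OF wp_floorlog_loop[where x = N and t = "E + 3"]])
         apply (simp_all add: w_gt(2,3) sm(1)[unfolded t_def])
    apply (rule wp_frame[OF wp_log_loop[where t = t and m = m]])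
            apply (simp_all add: w_gt(2,3) t sm1[simplified] t_def[symmetric])
    apply (rule wp_frame[OF wp_pow_loop[where n = "m * m"]])
           apply (simp_all add: w_gt(2,3) w4 md sm M_def[symmetric])
    apply (rule wp_mono[OF el])
              apply (simp_all add: md SM)[10]
    subgoal premises p for k1 s1 k2 s2 k3 s3 k4 s4
    proof -
      have "k1 + (k2 + (k3 + k4)) + 200 \<le> 1000 * (N + 1) * S\<^sup>2"
        by (rule cost) (use p in simp_all)
      then show ?thesis using p by simp
    qed
    done
qed

end

section \<open>Size and time bounds\<close>

text \<open>A bound on \<open>savitch_depth\<close>: the 4 comes from 3 and the rounding in
  \<open>floorlog\<close>, the leading 1 from rounding up to a power of 2.\<close>

definition savitch_exp :: "(nat \<Rightarrow> real) \<Rightarrow> nat \<Rightarrow> real" where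
  "savitch_exp s N = 1 + log 2 (max 1 (s N) + 4 + log 2 (real N))"

text \<open>With depth m the tensors have \<open>2 ^ (2 * m^2 + 2)\<close> entries. The 6 in place
  of 2 leaves room for the quadratic size of the branching programs, so that one bound serves both
  reductions.\<close>

definition savitch_bound :: "(nat \<Rightarrow> real) \<Rightarrow> nat \<Rightarrow> real" where
  "savitch_bound s N = 2 powr (2 * (savitch_exp s N)\<^sup>2 + 6)"

lemma log2_nonneg: "0 \<le> log 2 (real N)"
  by (cases "N = 0") (auto simp: log_def)

lemma savitch_exp_ge: "1 \<le> savitch_exp s N"
  using log2_nonneg[of N] by (simp add: savitch_exp_def)

lemma savitch_bound_ge: "64 * (max 1 (s N) + 4)\<^sup>2 \<le> savitch_bound s N"
proof -
  let ?x = "max 1 (s N) + 4" and ?m = "savitch_exp s N"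
  have m: "1 \<le> ?m" by (rule savitch_exp_ge)
  have "log 2 ?x \<le> ?m" unfolding savitch_exp_def using log2_nonneg[of N]
    by (smt (verit) log_le_cancel_iff)
  then have "?x \<le> 2 powr ?m" by (simp add: log_le_iff)
  then have "?x\<^sup>2 \<le> (2 powr ?m)\<^sup>2" by (intro power_mono) auto
  also have "\<dots> = 2 powr (2 * ?m)" by (simp add: powr_power)
  finally have "64 * ?x\<^sup>2 \<le> 2 powr 6 * 2 powr (2 * ?m)" by simp
  also have "\<dots> = 2 powr (6 + 2 * ?m)" by (rule powr_add[symmetric])
  also have "\<dots> \<le> savitch_bound s N"
    unfolding savitch_bound_def
  proof (rule powr_mono)
    have "?m * 1 \<le> ?m * ?m" using m by (intro mult_left_mono) auto
    then show "6 + 2 * ?m \<le> 2 * ?m\<^sup>2 + 6" by (simp add: power2_eq_square)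
  qed simp
  finally show ?thesis .
qed

text \<open>With \<open>l = log 2 (real N)\<close>, the exponent of the new bound is at most the
  square of \<open>l powr max (\<delta> N) 0\<close> times a power of a logarithm of l. Squaring
  only doubles the exponent, and the logarithmic factor is a power of l with vanishing
  exponent.\<close>

lemma small_size_bound_savitch_bound:
  assumes "small_size_bound s"
  shows "small_size_bound (savitch_bound s)"
proof -
  obtain \<delta> where \<delta>: "\<delta> \<longlonglongrightarrow> 0"
    "\<forall>\<^sub>F N in sequentially. s N \<le> 2 powr (log 2 (real N) powr \<delta> N)"
    using assms unfolding small_size_bound_def by blast
  \<comment> \<open>The 8 comes from \<open>2 * m^2 + 6 \<le> 8 * m^2\<close> for
    \<open>m \<ge> 1\<close>, the square from
    \<open>m \<le> D * (2 + log 2 (5 + l))\<close>.\<close>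
  define \<phi> where "\<phi> N = 8 * (2 + log 2 (5 + log 2 (real N)))\<^sup>2" for N
  \<comment> \<open>The maximum with 0 makes \<open>D\<close> at least 1, so that \<open>D\<close>
    can absorb summands as a factor. The quotient is the exponent that turns l into
    \<open>\<phi> N\<close>.\<close>
  define \<delta>' where "\<delta>' N = 2 * max (\<delta> N) 0 + ln (\<phi> N) / ln (log 2 (real N))" for N
  have "(\<lambda>N. ln (\<phi> N) / ln (log 2 (real N))) \<longlonglongrightarrow> 0" unfolding \<phi>_def by real_asymp
  moreover have "(\<lambda>N. 2 * max (\<delta> N) 0) \<longlonglongrightarrow> 2 * max 0 0"
    by (intro tendsto_intros \<delta>)
  ultimately have lim: "\<delta>' \<longlonglongrightarrow> 0" unfolding \<delta>'_def using tendsto_add by fastforce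
  have "\<forall>\<^sub>F N in sequentially. 1 < log 2 (real N)" by real_asymp
  with \<delta>(2) have "\<forall>\<^sub>F N in sequentially. savitch_bound s N \<le> 2 powr (log 2 (real N) powr \<delta>' N)"
  proof eventually_elim
    case (elim N)
    define l where "l = log 2 (real N)"
    define D where "D = l powr max (\<delta> N) 0"
    define m where "m = savitch_exp s N"
    have l: "1 < l" using elim by (simp add: l_def)
    have D: "1 \<le> D" using l by (simp add: D_def ge_one_powr_ge_zero)
    have "l powr \<delta> N \<le> D" unfolding D_def using l by (intro powr_mono) auto
    then have "2 powr (l powr \<delta> N) \<le> 2 powr D" by (intro powr_mono) auto
    moreover have D1: "1 \<le> 2 powr D" using D by (intro ge_one_powr_ge_zero) auto
    ultimately have s: "max 1 (s N) \<le> 2 powr D" using elim(1)[folded l_def] by linarith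
    have "(4 + l) * 1 \<le> (4 + l) * 2 powr D" using D1 l by (intro mult_left_mono) auto
    with s have "max 1 (s N) + (4 + l) * 1 \<le> 2 powr D + (4 + l) * 2 powr D" by (rule add_mono)
    also have "\<dots> = 2 powr D * (5 + l)" by (simp add: algebra_simps)
    finally have "max 1 (s N) + 4 + l \<le> 2 powr D * (5 + l)" by (simp add: add.assoc)
    then have "log 2 (max 1 (s N) + 4 + l) \<le> log 2 (2 powr D * (5 + l))" using l by simp
    also have "\<dots> = D + log 2 (5 + l)" using l by (simp add: log_mult)
    finally have "m \<le> 1 + D + log 2 (5 + l)" by (simp add: m_def savitch_exp_def l_def)
    also have "\<dots> \<le> D * (2 + log 2 (5 + l))"
    proof -
      have "1 * (1 + log 2 (5 + l)) \<le> D * (1 + log 2 (5 + l))" using D l by (intro mult_right_mono) auto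
      then show ?thesis by (simp add: algebra_simps)
    qed
    finally have "m\<^sup>2 \<le> (D * (2 + log 2 (5 + l)))\<^sup>2"
      using savitch_exp_ge[of s N] by (intro power_mono) (auto simp: m_def)
    then have m2: "8 * m\<^sup>2 \<le> D\<^sup>2 * \<phi> N" by (simp add: \<phi>_def l_def power_mult_distrib)
    have "1 \<le> m\<^sup>2" using savitch_exp_ge[of s N] by (simp add: m_def)
    then have "2 * m\<^sup>2 + 6 \<le> D\<^sup>2 * \<phi> N" using m2 by linarith
    also have "\<dots> = l powr \<delta>' N"
    proof -
      have "0 < log 2 (5 + l)" using l by simp
      then have "0 < \<phi> N" unfolding \<phi>_def l_def[symmetric] by simp
      then have "l powr (ln (\<phi> N) / ln l) = \<phi> N" using l by (simp add: powr_def)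
      moreover have "D\<^sup>2 = l powr (2 * max (\<delta> N) 0)" using l by (simp add: D_def powr_power)
      ultimately show ?thesis by (simp add: \<delta>'_def powr_add l_def[symmetric])
    qed
    finally show ?case unfolding savitch_bound_def m_def[symmetric] l_def[symmetric]
      by (intro powr_mono) auto
  qed
  with lim show ?thesis unfolding small_size_bound_def by blast
qed

text \<open>Once \<open>\<delta> N < 1 / 2\<close>, the power of the size is at most N to the k /
  sqrt l, where l is the logarithm of N, and the constant factor is N to an O(1 / l); both exponents
  tend to 0.\<close>

lemma near_linear_small_size:
  fixes C :: real and k :: nat
  assumes "small_size_bound s" "1 \<le> C"
  shows "near_linear (\<lambda>N. C * (real N + 1) * (max 1 (s N)) ^ k)"
proof -
  obtain \<delta> where \<delta>: "\<delta> \<longlonglongrightarrow> 0"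
    "\<forall>\<^sub>F N in sequentially. s N \<le> 2 powr (log 2 (real N) powr \<delta> N)"
    using assms(1) unfolding small_size_bound_def by blast
  define \<epsilon> where "\<epsilon> N = log 2 (2 * C) * (1 / log 2 (real N)) +
    real k * (log 2 (real N) powr (1 / 2) / log 2 (real N))" for N
  have "(\<lambda>N. 1 / log 2 (real N)) \<longlonglongrightarrow> 0" by real_asymp
  moreover have "(\<lambda>N. log 2 (real N) powr (1 / 2) / log 2 (real N)) \<longlonglongrightarrow> 0" by real_asymp
  ultimately have "\<epsilon> \<longlonglongrightarrow> log 2 (2 * C) * 0 + real k * 0"
    unfolding \<epsilon>_def by (intro tendsto_intros)
  then have lim: "\<epsilon> \<longlonglongrightarrow> 0" by simp
  have "\<forall>\<^sub>F N in sequentially. \<delta> N < 1 / 2"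
    using \<delta>(1) by (rule order_tendstoD) simp
  moreover have "\<forall>\<^sub>F N in sequentially. 1 < log 2 (real N)" by real_asymp
  ultimately have "\<forall>\<^sub>F N in sequentially.
      C * (real N + 1) * (max 1 (s N)) ^ k \<le> real N powr (1 + \<epsilon> N)"
    using \<delta>(2)
  proof eventually_elim
    case (elim N)
    define l where "l = log 2 (real N)"
    have l: "1 < l" using elim by (simp add: l_def)
    have N: "1 \<le> real N" using l by (cases N) (auto simp: l_def log_def)
    have N2: "real N = 2 powr l" using N by (simp add: l_def)
    have "l powr \<delta> N \<le> l powr (1 / 2)" using l elim(1) by (intro powr_mono) auto
    then have "2 powr (l powr \<delta> N) \<le> 2 powr (l powr (1 / 2))" by (rule powr_mono) simp
    moreover have "1 \<le> 2 powr (l powr (1 / 2))" by (intro ge_one_powr_ge_zero) auto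
    ultimately have "max 1 (s N) \<le> 2 powr (l powr (1 / 2))" using elim(3)[folded l_def] by linarith
    then have "(max 1 (s N)) ^ k \<le> (2 powr (l powr (1 / 2))) ^ k" by (intro power_mono) auto
    also have "\<dots> = 2 powr (real k * l powr (1 / 2))" by (simp add: powr_power mult.commute)
    finally have s: "(max 1 (s N)) ^ k \<le> 2 powr (real k * l powr (1 / 2))" .
    have "C * 1 \<le> C * real N" using N assms(2) by (intro mult_left_mono) auto
    then have "C * (real N + 1) \<le> 2 * C * real N" by (simp add: algebra_simps)
    then have "C * (real N + 1) * (max 1 (s N)) ^ k \<le> 2 * C * real N * 2 powr (real k * l powr (1 / 2))"
      by (rule mult_mono[OF _ s]) (use assms(2) in auto)
    also have "\<dots> = 2 powr (log 2 (2 * C)) * 2 powr l * 2 powr (real k * l powr (1 / 2))"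
      using assms(2) N2 by simp
    also have "\<dots> = 2 powr (log 2 (2 * C) + l + real k * l powr (1 / 2))" by (simp add: powr_add)
    also have "log 2 (2 * C) + l + real k * l powr (1 / 2) = l * (1 + \<epsilon> N)"
      using l by (simp add: \<epsilon>_def l_def[symmetric] field_simps)
    also have "2 powr (l * (1 + \<epsilon> N)) = real N powr (1 + \<epsilon> N)" by (simp add: N2 powr_powr)
    finally show ?case .
  qed
  with lim show ?thesis unfolding near_linear_def by blast
qed

text \<open>Eventually \<open>\<tau> N\<close> is at most N^2, which fits into twice the bits of N.
  The finitely many exceptions are bounded by some \<open>C\<close>, and \<open>C\<close> bits hold
  it; the maximum with 2 makes sure that \<open>C\<close> is multiplied by at least 1.\<close>

lemma near_linear_word:
  assumes "near_linear \<tau>"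
  obtains c where "1 \<le> c" "\<And>N x. real x \<le> \<tau> N \<Longrightarrow> x < 2 ^ (c * floorlog 2 (max N 2))"
proof -
  obtain \<epsilon> where \<epsilon>: "\<epsilon> \<longlonglongrightarrow> 0" "\<forall>\<^sub>F N in sequentially. \<tau> N \<le> real N powr (1 + \<epsilon> N)"
    using assms unfolding near_linear_def by blast
  have "\<forall>\<^sub>F N in sequentially. \<epsilon> N < 1" using \<epsilon>(1) by (rule order_tendstoD) simp
  with \<epsilon>(2) eventually_gt_at_top[of 0] have "\<forall>\<^sub>F N in sequentially. \<tau> N \<le> (real N)\<^sup>2"
  proof eventually_elim
    case (elim N)
    have "\<tau> N \<le> real N powr (1 + \<epsilon> N)" by (rule elim)
    also have "\<dots> \<le> real N powr 2" using elim by (intro powr_mono) auto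
    finally show ?case using elim by simp
  qed
  then obtain N0 where N0: "\<And>N. N0 \<le> N \<Longrightarrow> \<tau> N \<le> (real N)\<^sup>2"
    unfolding eventually_sequentially by blast
  define C where "C = (\<Sum>N<N0. nat \<lceil>\<bar>\<tau> N\<bar>\<rceil>)"
  have fl: "1 \<le> floorlog 2 (max N 2)" "N < 2 ^ floorlog 2 (max N 2)" for N
  proof -
    have *: "max N 2 < 2 ^ floorlog 2 (max N 2)" using floorlog_bounds[of "max N 2" 2] by simp
    then show "N < 2 ^ floorlog 2 (max N 2)" by simp
    show "1 \<le> floorlog 2 (max N 2)" using * by (cases "floorlog 2 (max N 2)") auto
  qed
  have "x < 2 ^ ((C + 2) * floorlog 2 (max N 2))" if x: "real x \<le> \<tau> N" for N x
  proof (cases "N < N0")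
    case True
    then have "nat \<lceil>\<bar>\<tau> N\<bar>\<rceil> \<le> C" unfolding C_def by (intro member_le_sum) auto
    moreover have "x \<le> nat \<lceil>\<bar>\<tau> N\<bar>\<rceil>" using x by linarith
    ultimately have "x \<le> C" by linarith
    also have "C < 2 ^ C" by (rule less_exp)
    also have "(2::nat) ^ C \<le> 2 ^ ((C + 2) * floorlog 2 (max N 2))"
    proof (rule power_increasing)
      have "C \<le> (C + 2) * 1" by simp
      also have "\<dots> \<le> (C + 2) * floorlog 2 (max N 2)" using fl(1) by (intro mult_le_mono2)
      finally show "C \<le> (C + 2) * floorlog 2 (max N 2)" .
    qed simp
    finally show ?thesis .
  next
    case False
    then have "real x \<le> (real N)\<^sup>2" using N0[of N] x by linarith
    then have "real x \<le> real (N\<^sup>2)" by simp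
    then have "x \<le> N\<^sup>2" by (simp only: of_nat_le_iff)
    also have "\<dots> < (2 ^ floorlog 2 (max N 2))\<^sup>2" using fl(2) by (intro power_strict_mono) auto
    also have "\<dots> = 2 ^ (2 * floorlog 2 (max N 2))" by (simp add: power_mult[symmetric] mult.commute)
    also have "\<dots> \<le> 2 ^ ((C + 2) * floorlog 2 (max N 2))" by (intro power_increasing mult_le_mono1) auto
    finally show ?thesis .
  qed
  then show thesis by (intro that[of "C + 2"]) auto
qed

lemma word_size_entry:
  assumes "1 \<le> c" "x \<in> insert (length inp) (set inp)"
  shows "x < 2 ^ word_size c inp"
proof -
  let ?M = "Max (insert (length inp) (set inp))"
  have "x \<le> ?M" using assms(2) by (intro Max_ge) auto
  also have "?M < 2 ^ floorlog 2 ?M"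
    using floorlog_bounds[of ?M 2] by (cases "?M = 0") auto
  also have "(2::nat) ^ floorlog 2 ?M \<le> 2 ^ word_size c inp"
    unfolding word_size_def using assms(1) by (intro power_increasing) auto
  finally show ?thesis .
qed

text \<open>The length of the input counts as well, which accounts for the 2 when N is
  smaller.\<close>

lemma word_size_ge:
  assumes "N \<in> set inp" "2 \<le> length inp"
  shows "(2::nat) ^ (c * floorlog 2 (max N 2)) \<le> 2 ^ word_size c inp"
proof -
  have "max N 2 \<le> Max (insert (length inp) (set inp))"
    using assms by (auto intro: Max_ge order_trans)
  then show ?thesis
    unfolding word_size_def by (intro power_increasing mult_le_mono2 floorlog_mono) auto
qed

section \<open>The reductions\<close>

lemma wp_imp_computes_in:
  assumes "wp (word_size c inp) inp p (\<lambda>k s. k \<le> t \<and> outp s = ys) init_state"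
  obtains k where "computes_in p c inp ys k" "k \<le> t"
  using assms unfolding wp_def computes_in_def by blast

text \<open>By minimality \<open>2 ^ (m - 1)\<close> is still below the required sum, so m exceeds
  the logarithm of the sum by at most 1.\<close>

lemma savitch_depth_le:
  assumes "real (bp_size (bpsp_bp I)) \<le> s (length (bpsp_A I))"
  shows "real (savitch_depth I) \<le> savitch_exp s (length (bpsp_A I))"
proof (cases "savitch_depth I")
  case 0
  then show ?thesis using savitch_exp_ge[of s] by (metis of_nat_0 order_trans zero_le_one)
next
  case (Suc j)
  let ?N = "length (bpsp_A I)"
  have fl: "real (floorlog 2 ?N) \<le> log 2 (real ?N) + 1"
  proof (cases "?N = 0")
    case True
    then show ?thesis by (simp add: floorlog_def log_def)
  next
    case False
    then have "real (nat \<lfloor>log 2 (real ?N)\<rfloor>) \<le> log 2 (real ?N)" using log2_nonneg[of ?N] by simp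
    then show ?thesis using False by (simp add: floorlog_def)
  qed
  have "2 ^ j < bp_size (bpsp_bp I) + 3 + floorlog 2 ?N" using savitch_depth(2)[of j I] Suc by simp
  then have "real (2 ^ j) < real (bp_size (bpsp_bp I) + 3 + floorlog 2 ?N)" by (simp only: of_nat_less_iff)
  also have "\<dots> \<le> max 1 (s ?N) + 4 + log 2 (real ?N)" using fl assms by simp
  finally have "2 powr real j < max 1 (s ?N) + 4 + log 2 (real ?N)" by (simp add: powr_realpow)
  then have "real j < log 2 (max 1 (s ?N) + 4 + log 2 (real ?N))"
    using log2_nonneg[of ?N] by (subst less_log_iff) auto
  then show ?thesis by (simp add: Suc savitch_exp_def)
qed

lemma savitch_tensor_size_le:
  assumes "real (bp_size (bpsp_bp I)) \<le> s (length (bpsp_A I))"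
  shows "real (4 * 4 ^ (savitch_depth I * savitch_depth I)) \<le> savitch_bound s (length (bpsp_A I))"
proof -
  let ?m = "savitch_depth I"
  have "(4::real) ^ (?m * ?m) = 2 ^ (2 * (?m * ?m))" by (simp add: power_mult)
  then have "real (4 * 4 ^ (?m * ?m)) = 2 ^ (2 * (?m * ?m) + 2)" by simp
  also have "\<dots> = 2 powr real (2 * (?m * ?m) + 2)" by (rule powr_realpow[symmetric]) simp
  also have "\<dots> \<le> savitch_bound s (length (bpsp_A I))"
    unfolding savitch_bound_def
  proof (rule powr_mono)
    have "(real ?m)\<^sup>2 \<le> (savitch_exp s (length (bpsp_A I)))\<^sup>2"
      using savitch_depth_le[of I s] assms by (intro power_mono) auto
    then show "real (2 * (?m * ?m) + 2) \<le> 2 * (savitch_exp s (length (bpsp_A I)))\<^sup>2 + 6"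
      by (simp add: power2_eq_square)
  qed simp
  finally show ?thesis .
qed

text \<open>Factor and exponent are the larger ones of the two programs, so this bound too serves
  both directions.\<close>

definition reduction_time :: "(nat \<Rightarrow> real) \<Rightarrow> nat \<Rightarrow> real" where
  "reduction_time s N = 6000 * (real N + 1) * (max 1 (savitch_bound s N)) ^ 3"

lemma reduction_time_ge:
  assumes "x \<le> 6000 * (N + 1) * D ^ 3" "real D \<le> savitch_bound s N"
  shows "real x \<le> reduction_time s N"
proof -
  have "real x \<le> real (6000 * (N + 1) * D ^ 3)" using assms(1) by (rule of_nat_mono)
  also have "\<dots> = 6000 * (real N + 1) * real D ^ 3" by simp
  also have "\<dots> \<le> reduction_time s N"
    unfolding reduction_time_def using assms(2) by (intro mult_left_mono power_mono) auto
  finally show ?thesis .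
qed

lemma near_linear_reduction_time:
  assumes "small_size_bound s"
  shows "near_linear (reduction_time s)"
  unfolding reduction_time_def
  by (rule near_linear_small_size[OF small_size_bound_savitch_bound[OF assms]]) simp

lemma OAPT_reducible_BPSP: "near_linear_reducible OAPT BP_Satisfying_Pair"
  unfolding near_linear_reducible_def
proof (intro allI impI)
  fix s assume s: "small_size_bound s"
  obtain c where c: "1 \<le> c" "\<And>N x. real x \<le> reduction_time s N \<Longrightarrow> x < 2 ^ (c * floorlog 2 (max N 2))"
    by (rule near_linear_word[OF near_linear_reduction_time[OF s]]) blast
  have "\<exists>y k. computes_in oapt_to_bpsp_prog c (enc OAPT I) (enc BP_Satisfying_Pair y) k \<and>
      real k \<le> reduction_time s (num OAPT I) \<and> inst BP_Satisfying_Pair y \<and>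
      real (dim BP_Satisfying_Pair y) \<le> savitch_bound s (num BP_Satisfying_Pair y) \<and>
      yes OAPT I = yes BP_Satisfying_Pair y"
    if "inst OAPT I \<and> real (dim OAPT I) \<le> s (num OAPT I)" for I
  proof -
    define t where "t = oapt_t I"
    define N where "N = length (oapt_A I)"
    define L :: nat where "L = 2 ^ t"
    let ?inp = "enc_oapt I" and ?V = "2 * L + 1"
    let ?w = "word_size c ?inp"
    have I: "oapt_inst I" and Ls: "real L \<le> s N"
      using that by (auto simp: OAPT_def L_def t_def N_def)
    have L1: "1 \<le> L" by (simp add: L_def)
    have edges: "2 * ?V * ?V \<le> 18 * (L * L)"
    proof -
      have "?V * ?V \<le> (3 * L) * (3 * L)" using L1 by (intro mult_le_mono) auto
      then show ?thesis by simp
    qed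
    have "18 * (real L * real L) \<le> savitch_bound s N"
    proof -
      have "real L * real L \<le> (max 1 (s N) + 4)\<^sup>2"
        unfolding power2_eq_square using Ls by (intro mult_mono) auto
      moreover have "0 \<le> real L * real L" by simp
      ultimately show ?thesis using savitch_bound_ge[of s N] by linarith
    qed
    then have D: "real (18 * (L * L)) \<le> savitch_bound s N" by simp
    \<comment> \<open>Everything up to the time bound fits into a word. The bound is taken at
      \<open>18 * (L * L)\<close> rather than \<open>L\<close> because the program also holds the
      number of edges in a register.\<close>
    have small: "x < 2 ^ ?w" if "x \<le> 6000 * (N + 1) * (18 * (L * L)) ^ 3" for x
    proof -
      have "x < 2 ^ (c * floorlog 2 (max N 2))" using c(2) reduction_time_ge[OF that D] .
      also have "\<dots> \<le> 2 ^ ?w" by (rule word_size_ge) (auto simp: enc_oapt_def N_def)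
      finally show ?thesis .
    qed
    have LD: "L \<le> 18 * (L * L)" using L1 by simp
    have D1: "1 \<le> 18 * (L * L)" using L1 by simp
    have D3: "18 * (L * L) \<le> (18 * (L * L)) ^ 3" using D1 by (rule self_le_power) simp
    have le: "x \<le> 6000 * (N + 1) * (18 * (L * L)) ^ 3" if "x \<le> 6000 * (N + 1) * (18 * (L * L))" for x
      using that mult_le_mono2[OF D3, of "6000 * (N + 1)"] by linarith
    have w2: "2 < (2::nat) ^ ?w" using small[OF le, of 2] L1 by simp
    have "wp ?w ?inp oapt_to_bpsp_prog
        (\<lambda>k s'. k \<le> 6000 * (N + 1) * L ^ 3 \<and> outp s' = enc_bpsp (oapt_to_bpsp I)) init_state"
    proof (rule wp_oapt_to_bpsp_prog[OF I refl t_def N_def L_def])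
      show "0 < ?w" using w2 by (cases ?w) auto
      show "2 < (2::nat) ^ ?w" by (rule w2)
      have "N * L \<le> N * (18 * (L * L))" using LD by (rule mult_le_mono2)
      then have "2 * N * L + 2 \<le> 2 * (N * (18 * (L * L))) + 2 * (18 * (L * L))"
        using D1 by linarith
      also have "\<dots> = 2 * (N + 1) * (18 * (L * L))" by (simp add: algebra_simps)
      also have "\<dots> \<le> 6000 * (N + 1) * (18 * (L * L))" by (intro mult_le_mono1) simp
      finally show "2 * N * L + 2 < 2 ^ ?w" by (intro small le)
      show "2 * ?V * ?V < 2 ^ ?w" using edges by (intro small le) (simp add: algebra_simps)
      show "N < 2 ^ ?w" "t < 2 ^ ?w"
        using c(1) by (auto simp: enc_oapt_def N_def t_def intro!: word_size_entry)
    qed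
    then obtain k where k: "computes_in oapt_to_bpsp_prog c ?inp (enc_bpsp (oapt_to_bpsp I)) k"
      "k \<le> 6000 * (N + 1) * L ^ 3"
      by (rule wp_imp_computes_in)
    have "k \<le> 6000 * (N + 1) * (18 * (L * L)) ^ 3"
      using k(2) by (rule order_trans) (intro mult_le_mono2 power_mono LD, simp)
    then have "real k \<le> reduction_time s N" using D by (rule reduction_time_ge)
    moreover have "real (bp_size (search_bp L)) \<le> savitch_bound s N"
    proof -
      have "bp_size (search_bp L) \<le> 18 * (L * L)"
        using edges by (simp only: bp_size_def search_bp_def bp.simps length_map length_upt diff_zero)
      then show ?thesis using D by linarith
    qed
    ultimately show ?thesis
      using k(1) oapt_to_bpsp_correct[OF I]
      by (intro exI[of _ "oapt_to_bpsp I"] exI[of _ k])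
        (simp add: OAPT_def BP_Satisfying_Pair_def oapt_to_bpsp_def N_def[symmetric] L_def t_def)
  qed
  then show "\<exists>s' \<tau> p c. small_size_bound s' \<and> near_linear \<tau> \<and>
    (\<forall>x. inst OAPT x \<and> real (dim OAPT x) \<le> s (num OAPT x) \<longrightarrow>
      (\<exists>y k. computes_in p c (enc OAPT x) (enc BP_Satisfying_Pair y) k \<and>
        real k \<le> \<tau> (num OAPT x) \<and> inst BP_Satisfying_Pair y \<and>
        real (dim BP_Satisfying_Pair y) \<le> s' (num BP_Satisfying_Pair y) \<and>
        yes OAPT x = yes BP_Satisfying_Pair y))"
    using small_size_bound_savitch_bound[OF s] near_linear_reduction_time[OF s] by blast
qed

lemma BPSP_reducible_OAPT: "near_linear_reducible BP_Satisfying_Pair OAPT"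
  unfolding near_linear_reducible_def
proof (intro allI impI)
  fix s assume s: "small_size_bound s"
  obtain c where c: "1 \<le> c" "\<And>N x. real x \<le> reduction_time s N \<Longrightarrow> x < 2 ^ (c * floorlog 2 (max N 2))"
    by (rule near_linear_word[OF near_linear_reduction_time[OF s]]) blast
  have "\<exists>y k. computes_in bpsp_to_oapt_prog c (enc BP_Satisfying_Pair I) (enc OAPT y) k \<and>
      real k \<le> reduction_time s (num BP_Satisfying_Pair I) \<and> inst OAPT y \<and>
      real (dim OAPT y) \<le> savitch_bound s (num OAPT y) \<and> yes BP_Satisfying_Pair I = yes OAPT y"
    if "inst BP_Satisfying_Pair I \<and> real (dim BP_Satisfying_Pair I) \<le> s (num BP_Satisfying_Pair I)" for I
  proof -
    define N where "N = length (bpsp_A I)"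
    define m where "m = savitch_depth I"
    define S :: nat where "S = 4 * 4 ^ (m * m)"
    let ?inp = "enc_bpsp I"
    let ?w = "word_size c ?inp"
    have I: "bpsp_inst I" and E: "real (bp_size (bpsp_bp I)) \<le> s N"
      using that by (auto simp: BP_Satisfying_Pair_def N_def)
    have D: "real S \<le> savitch_bound s N"
      unfolding S_def m_def N_def using E by (intro savitch_tensor_size_le) (simp add: N_def)
    have S1: "1 \<le> S" by (simp add: S_def)
    interpret bpsp_input I ?w
    proof
      show "bpsp_inst I" by (rule I)
      show "x < 2 ^ ?w" if "x \<in> set ?inp" for x using that c(1) by (intro word_size_entry) auto
      show "length ?inp < 2 ^ ?w" using c(1) by (intro word_size_entry) auto
    qed
    have "S ^ 1 \<le> S ^ 3" "S ^ 2 \<le> S ^ 3" using S1 by (intro power_increasing; simp)+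
    then have "2 * (N + 1) * S \<le> 6000 * (N + 1) * S ^ 3" "1000 * (N + 1) * S\<^sup>2 \<le> 6000 * (N + 1) * S ^ 3"
      by (intro mult_le_mono; simp)+
    note le = reduction_time_ge[OF this(1) D] reduction_time_ge[OF this(2) D]
    have "2 * (N + 1) * S < 2 ^ (c * floorlog 2 (max N 2))" using le(1) by (rule c(2))
    also have "\<dots> \<le> 2 ^ ?w" by (rule word_size_ge) (auto simp: enc_bpsp_def N_def)
    finally have w: "2 * (N + 1) * S < 2 ^ ?w" .
    obtain k where k: "computes_in bpsp_to_oapt_prog c ?inp (enc_oapt (bpsp_to_oapt I)) k"
      "k \<le> 1000 * (N + 1) * S\<^sup>2"
      using wp_imp_computes_in[OF wp_bpsp_to_oapt_prog[OF m_def S_def w[unfolded N_def]]] unfolding N_def .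
    have "real k \<le> reduction_time s N" using k(2) le(2) by linarith
    moreover have "2 ^ oapt_t (bpsp_to_oapt I) = S" "length (oapt_A (bpsp_to_oapt I)) = N"
      by (simp_all add: bpsp_to_oapt_def Let_def S_def m_def N_def power_mult power_add)
    ultimately show ?thesis
      using k(1) bpsp_to_oapt_correct[OF I] D
      by (intro exI[of _ "bpsp_to_oapt I"] exI[of _ k])
        (simp add: OAPT_def BP_Satisfying_Pair_def N_def[symmetric])
  qed
  then show "\<exists>s' \<tau> p c. small_size_bound s' \<and> near_linear \<tau> \<and>
    (\<forall>x. inst BP_Satisfying_Pair x \<and> real (dim BP_Satisfying_Pair x) \<le> s (num BP_Satisfying_Pair x) \<longrightarrow>
      (\<exists>y k. computes_in p c (enc BP_Satisfying_Pair x) (enc OAPT y) k \<and>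
        real k \<le> \<tau> (num BP_Satisfying_Pair x) \<and> inst OAPT y \<and>
        real (dim OAPT y) \<le> s' (num OAPT y) \<and> yes BP_Satisfying_Pair x = yes OAPT y))"
    using small_size_bound_savitch_bound[OF s] near_linear_reduction_time[OF s] by blast
qed

theorem theorem5p4:
  shows "near_linear_equivalent OAPT BP_Satisfying_Pair"
  unfolding near_linear_equivalent_def
  using OAPT_reducible_BPSP BPSP_reducible_OAPT by blast

end
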